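(* Let $g:X\to\mathbb{R}\cup\{+\infty\}$ be a (not necessarily convex) function and let $f:X^*\to\overline{\mathbb{R}}$ be its Fenchel conjugate, $f(x^* ):=\sup_{x\in X}(\langle x,x^*\rangle-g(x))$. Assume that $f$ is proper. Then, for every $x^*\in X^*$, $$\partial f(x^* )=\bigcap_{L\in\mathcal{F}(x^* )}\operatorname{co}\left\{\bigcap_{\varepsilon>0}\operatorname{cl}^{w}\left((\partial_\varepsilon g)^{-1}(x^* )+\mathrm{N}_{L\cap\operatorname{dom}f}(x^* )\right)\right\}.$$ If, in addition, $f$ is finite and weak*-continuous at some point, then, for every $x^*\in X^*$, $$\partial f(x^* )=\overline{\operatorname{co}}\left\{(\partial(\operatorname{cl}^{w}g))^{-1}(x^* )\right\}+\mathrm{N}_{\operatorname{dom}f}(x^* ),$$ and, if moreover $X=\mathbb{R}^n$, $$\partial f(x^* )=\operatorname{co}\left\{(\partial(\operatorname{cl}g))^{-1}(x^* )\right\}+\mathrm{N}_{\operatorname{dom}f}(x^* ).$$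
   Context: $X$ is a real separated (Hausdorff) locally convex space with topological dual $X^*$ endowed with the $w^*$-topology, so that the dual of $X^*$ is $X$. In $X$, $\operatorname{cl}^w$ denotes closure for the weak topology, $\operatorname{co}$ the convex hull and $\overline{\operatorname{co}}$ the closed convex hull. A function is proper if it is not identically $+\infty$ and never takes the value $-\infty$; $\operatorname{dom}f=\{x^*:f(x^* )<+\infty\}$. $\operatorname{cl}^wg$ is the weakly lower semicontinuous hull of $g$ (the function whose epigraph is the closure of $\operatorname{epi}g$ for the weak topology of $X$ times the usual topology of $\mathbb{R}$); in $\mathbb{R}^n$, $\operatorname{cl}g$ is the lsc hull. For $h:X\to\overline{\mathbb{R}}$ and $\varepsilon\ge0$, $\partial_\varepsilon h(x)=\{x^*\in X^*: h(y)\ge h(x)+\langle x^*,y-x\rangle-\varepsilon\ \forall y\in X\}$ if $h(x)\in\mathbb{R}$, and $\emptyset$ otherwise; $\partial h=\partial_0h$; $(\partial_\varepsilon h)^{-1}(x^* )=\{x\in X:x^*\in\partial_\varepsilon h(x)\}$. The subdifferential of $f$ is taken in $X$: $\partial f(x^* )=\{x\in X:f(y^* )\ge f(x^* )+\langle x,y^*-x^*\rangle\ \forall y^*\in X^*\}$ if $f(x^* )\in\mathbb{R}$, and $\emptyset$ otherwise. For $A\subset X^*$, $\mathrm{N}_A(x^* )=\{x\in X:\langle x,z^*-x^*\rangle\le0\ \forall z^*\in A\}$ if $x^*\in A$, and $\emptyset$ otherwise. Minkowski sums satisfy $A+\emptyset=\emptyset+A=\emptyset$. $\mathcal{F}(x^*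 )$ is the family of finite-dimensional linear subspaces $L\subset X^*$ containing $x^*$. *)

theory Defs
  imports "HOL-Analysis.Analysis"
begin

text \<open>
  The last axiom spells out convexity of \<open>V\<close>, because the constant \<open>convex\<close> cannot be
  applied to the type being axiomatised.
\<close>

class locally_convex_space = real_vector + topological_ab_group_add + t2_space +
  assumes tendsto_scaleR_nhds:
    "LIM p (nhds (c::real) \<times>\<^sub>F nhds x). fst p *\<^sub>R snd p :> nhds (c *\<^sub>R x)"
  assumes convex_nhds_base_raw:
    "open U \<Longrightarrow> 0 \<in> U \<Longrightarrow> \<exists>V. open V \<and> 0 \<in> V \<and> V \<subseteq> U \<and>
      (\<forall>x\<in>V. \<forall>y\<in>V. \<forall>u\<ge>0. \<forall>v\<ge>0. u + v = 1 \<longrightarrow> u *\<^sub>R x + v *\<^sub>R y \<in> V)"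

lemma convex_nhds_base:
  fixes U :: "'a::locally_convex_space set"
  assumes "open U" "0 \<in> U"
  shows "\<exists>V. open V \<and> 0 \<in> V \<and> convex V \<and> V \<subseteq> U"
  using convex_nhds_base_raw[OF assms] unfolding convex_def by blast

instance real_normed_vector \<subseteq> locally_convex_space
proof
  fix c :: real and x :: 'a
  show "LIM p (nhds c \<times>\<^sub>F nhds x). fst p *\<^sub>R snd p :> nhds (c *\<^sub>R x)"
    by (intro tendsto_scaleR filterlim_fst filterlim_snd)
next
  fix U :: "'a set"
  assume "open U" "0 \<in> U"
  then obtain e where "e > 0" "ball 0 e \<subseteq> U"
    by (auto simp: open_contains_ball)
  then show "\<exists>V. open V \<and> 0 \<in> V \<and> V \<subseteq> U \<and>
      (\<forall>x\<in>V. \<forall>y\<in>V. \<forall>u\<ge>0. \<forall>v\<ge>0. u + v = 1 \<longrightarrow> u *\<^sub>R x + v *\<^sub>R y \<in> V)"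
    using convex_ball[of "0::'a" e] unfolding convex_def
    by (intro exI[of _ "ball 0 e"]) auto
qed

typedef (overloaded) ('a::"{real_vector, topological_space}") top_dual =
    "{\<phi> :: 'a \<Rightarrow> real. linear \<phi> \<and> continuous_on UNIV \<phi>}"
  morphisms dual_apply Dual
  by (rule exI[of _ "\<lambda>_. 0"]) (auto intro!: linearI)

setup_lifting type_definition_top_dual

lemma linear_dual_apply: "linear (dual_apply \<phi>)"
  using dual_apply[of \<phi>] by simp

lemma continuous_on_dual_apply: "continuous_on UNIV (dual_apply \<phi>)"
  using dual_apply[of \<phi>] by simp

lemma top_dual_eqI: "(\<And>x. dual_apply \<phi> x = dual_apply \<psi> x) \<Longrightarrow> \<phi> = \<psi>"
  by (auto simp flip: dual_apply_inject)

instantiation top_dual :: ("{real_vector, topological_space}") real_vector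
begin

lift_definition zero_top_dual :: "'a top_dual" is "\<lambda>_. 0"
  by (auto intro!: linearI)

lift_definition plus_top_dual :: "'a top_dual \<Rightarrow> 'a top_dual \<Rightarrow> 'a top_dual"
  is "\<lambda>\<phi> \<psi> x. \<phi> x + \<psi> x"
  by (auto intro: linear_compose_add continuous_on_add)

lift_definition uminus_top_dual :: "'a top_dual \<Rightarrow> 'a top_dual"
  is "\<lambda>\<phi> x. - \<phi> x"
  by (auto intro: linear_compose_neg continuous_on_minus)

lift_definition minus_top_dual :: "'a top_dual \<Rightarrow> 'a top_dual \<Rightarrow> 'a top_dual"
  is "\<lambda>\<phi> \<psi> x. \<phi> x - \<psi> x"
  by (auto intro: linear_compose_sub continuous_on_diff)

lift_definition scaleR_top_dual :: "real \<Rightarrow> 'a top_dual \<Rightarrow> 'a top_dual"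
  is "\<lambda>c \<phi> x. c * \<phi> x"
  by (auto intro!: continuous_intros linearI simp: linear_add linear_scale algebra_simps)

instance
  by standard (transfer; simp add: algebra_simps fun_eq_iff)+

end

lemma dual_apply_simps [simp]:
  "dual_apply 0 x = 0"
  "dual_apply (\<phi> + \<psi>) x = dual_apply \<phi> x + dual_apply \<psi> x"
  "dual_apply (- \<phi>) x = - dual_apply \<phi> x"
  "dual_apply (\<phi> - \<psi>) x = dual_apply \<phi> x - dual_apply \<psi> x"
  "dual_apply (c *\<^sub>R \<phi>) x = c * dual_apply \<phi> x"
  by (transfer; simp)+

text \<open>The coarsest topology making every evaluation \<open>\<phi> \<mapsto> \<phi> x\<close> continuous.\<close>

instantiation top_dual :: ("{real_vector, topological_space}") topological_space
begin

definition open_top_dual :: "'a top_dual set \<Rightarrow> bool" where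
  "open_top_dual = generate_topology {(\<lambda>\<phi>. dual_apply \<phi> x) -` V | x V. open V}"

instance
  by standard (auto simp: open_top_dual_def intro: generate_topology.intros)

end

lemma open_vimage_dual_apply: "open V \<Longrightarrow> open ((\<lambda>\<phi>. dual_apply \<phi> x) -` V)"
  unfolding open_top_dual_def by (rule generate_topology.Basis) blast

instance top_dual :: ("{real_vector, topological_space}") t2_space
proof
  fix \<phi> \<psi> :: "'a top_dual"
  assume "\<phi> \<noteq> \<psi>"
  then obtain x where x: "dual_apply \<phi> x \<noteq> dual_apply \<psi> x"
    using top_dual_eqI by blast
  obtain U V where "open U" "open V" "dual_apply \<phi> x \<in> U" "dual_apply \<psi> x \<in> V" "U \<inter> V = {}"
    using hausdorff[OF x] by metis
  then show "\<exists>U V. open U \<and> open V \<and> \<phi> \<in> U \<and> \<psi> \<in> V \<and> U \<inter> V = {}"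
    by (intro exI[of _ "(\<lambda>\<phi>. dual_apply \<phi> x) -` U"] exI[of _ "(\<lambda>\<phi>. dual_apply \<phi> x) -` V"])
      (auto intro: open_vimage_dual_apply)
qed

definition weak_topology :: "'a::{real_vector, topological_space} topology" where
  "weak_topology = topology_generated_by {dual_apply \<phi> -` V | \<phi> V. open V}"

lemma topspace_weak_topology [simp]: "topspace weak_topology = UNIV"
proof -
  have "UNIV \<in> {dual_apply \<phi> -` V | \<phi> V. open V}"
    by (intro CollectI exI[of _ 0] exI[of _ UNIV]) simp
  then show ?thesis
    unfolding weak_topology_def topology_generated_by_topspace by blast
qed

definition epi :: "('a \<Rightarrow> ereal) \<Rightarrow> ('a \<times> real) set" where
  "epi h = {(x, t). h x \<le> ereal t}"

text \<open>
  With \<open>T = weak_topology\<close> this is the weakly lower semicontinuous hull, with \<open>T = euclidean\<close> the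
  hull for the topology of the type. Its epigraph is the closure of the epigraph of \<open>h\<close>
  (lemma \<open>epi_lsc_hull\<close>); the infimum over the empty set is \<open>\<infinity>\<close>.
\<close>

definition lsc_hull :: "'a topology \<Rightarrow> ('a \<Rightarrow> ereal) \<Rightarrow> 'a \<Rightarrow> ereal" where
  "lsc_hull T h x = Inf (ereal ` {t. (x, t) \<in> prod_topology T euclideanreal closure_of epi h})"

lemma epi_lsc_hull:
  assumes "topspace T = UNIV"
  shows "epi (lsc_hull T h) = prod_topology T euclideanreal closure_of epi h"
    (is "_ = ?C")
proof -
  have mem: "(x, t) \<in> ?C \<longleftrightarrow> (\<forall>U V. openin T U \<longrightarrow> open V \<longrightarrow> x \<in> U \<longrightarrow> t \<in> V \<longrightarrow>
      (\<exists>y s. h y \<le> ereal s \<and> y \<in> U \<and> s \<in> V))" (is "_ \<longleftrightarrow> ?R x t") for x t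
  proof
    assume C: "(x, t) \<in> ?C"
    show "?R x t"
    proof (intro allI impI)
      fix U V assume "openin T U" "open V" "x \<in> U" "t \<in> V"
      then have "openin (prod_topology T euclideanreal) (U \<times> V)" "(x, t) \<in> U \<times> V"
        by (auto simp: openin_prod_Times_iff)
      with C have "\<exists>p. p \<in> epi h \<and> p \<in> U \<times> V"
        unfolding in_closure_of by metis
      then show "\<exists>y s. h y \<le> ereal s \<and> y \<in> U \<and> s \<in> V"
        by (auto simp: epi_def)
    qed
  next
    assume R: "?R x t"
    show "(x, t) \<in> ?C"
      unfolding in_closure_of
    proof (intro conjI allI impI)
      show "(x, t) \<in> topspace (prod_topology T euclideanreal)" using assms by simp
      fix W assume "(x, t) \<in> W \<and> openin (prod_topology T euclideanreal) W"
      then have "\<exists>U V. openin T U \<and> open V \<and> x \<in> U \<and> t \<in> V \<and> U \<times> V \<subseteq> W"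
        by (simp add: openin_prod_topology_alt)
      then obtain U V where UV: "openin T U" "open V" "x \<in> U" "t \<in> V" "U \<times> V \<subseteq> W"
        by (elim exE conjE)
      obtain y s where "h y \<le> ereal s" "y \<in> U" "s \<in> V"
        using R[rule_format, OF UV(1-4)] by (elim exE conjE)
      then show "\<exists>p. p \<in> epi h \<and> p \<in> W"
        using UV by (intro exI[of _ "(y, s)"]) (auto simp: epi_def)
    qed
  qed
  have closed: "(x, t) \<in> ?C" if inf: "Inf (ereal ` {t. (x, t) \<in> ?C}) \<le> ereal t" for x t
    unfolding mem
  proof (intro allI impI)
    fix U V assume UV: "openin T U" "open V" "x \<in> U" "t \<in> V"
    obtain e where e: "e > 0" "ball t e \<subseteq> V"
      using UV by (auto simp: open_contains_ball)
    have "Inf (ereal ` {t. (x, t) \<in> ?C}) < ereal (t + e/2)"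
      using e by (intro le_less_trans[OF inf]) simp
    then obtain r where r: "(x, r) \<in> ?C" "r < t + e/2"
      by (auto simp: Inf_less_iff)
    have r': "r \<in> ball r (e/2)"
      using e(1) by simp
    obtain y s where ys: "h y \<le> ereal s" "y \<in> U" "s \<in> ball r (e/2)"
      using r(1)[unfolded mem, rule_format, OF UV(1) open_ball UV(3) r'] by (elim exE conjE)
    have "h y \<le> ereal (max s t)"
      using ys(1) by (rule order_trans) simp
    moreover have "max s t \<in> V"
    proof (rule subsetD[OF e(2)])
      have "\<bar>r - s\<bar> < e/2"
        using ys(3) by (simp add: dist_real_def)
      then have "\<bar>t - max s t\<bar> < e"
        using r(2) e(1) by linarith
      then show "max s t \<in> ball t e"
        by (simp add: dist_real_def)
    qed
    ultimately show "\<exists>y s. h y \<le> ereal s \<and> y \<in> U \<and> s \<in> V"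
      using ys(2) by blast
  qed
  have "(x, t) \<in> epi (lsc_hull T h) \<longleftrightarrow> (x, t) \<in> ?C" for x t
    unfolding epi_def[of "lsc_hull T h"] lsc_hull_def using closed[of x t] by (auto intro: Inf_lower)
  then show ?thesis
    by auto
qed

definition edom :: "('a \<Rightarrow> ereal) \<Rightarrow> 'a set" where
  "edom f = {x. f x < \<infinity>}"

definition proper :: "('a \<Rightarrow> ereal) \<Rightarrow> bool" where
  "proper f \<longleftrightarrow> (\<exists>x. f x \<noteq> \<infinity>) \<and> (\<forall>x. f x \<noteq> -\<infinity>)"

text \<open>Where \<open>g x = \<infinity>\<close>, the term under the supremum is \<open>-\<infinity>\<close>.\<close>

definition conjugate ::
    "('a::{real_vector, topological_space} \<Rightarrow> ereal) \<Rightarrow> 'a top_dual \<Rightarrow> ereal" where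
  "conjugate g \<phi> = (SUP x. ereal (dual_apply \<phi> x) - g x)"

definition eps_subdiff ::
    "real \<Rightarrow> ('a::{real_vector, topological_space} \<Rightarrow> ereal) \<Rightarrow> 'a \<Rightarrow> 'a top_dual set" where
  "eps_subdiff \<epsilon> h x =
    (if \<bar>h x\<bar> \<noteq> \<infinity>
     then {\<phi>. \<forall>y. h y \<ge> h x + ereal (dual_apply \<phi> (y - x)) - ereal \<epsilon>} else {})"

abbreviation subdiff ::
    "('a::{real_vector, topological_space} \<Rightarrow> ereal) \<Rightarrow> 'a \<Rightarrow> 'a top_dual set" where
  "subdiff \<equiv> eps_subdiff 0"

definition set_valued_inv :: "('a \<Rightarrow> 'b set) \<Rightarrow> 'b \<Rightarrow> 'a set" where
  "set_valued_inv F y = {x. y \<in> F x}"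

text \<open>Functions and sets on the dual have subgradients and normals in the primal space.\<close>

definition dual_subdiff ::
    "('a::{real_vector, topological_space} top_dual \<Rightarrow> ereal) \<Rightarrow> 'a top_dual \<Rightarrow> 'a set" where
  "dual_subdiff f \<phi> =
    (if \<bar>f \<phi>\<bar> \<noteq> \<infinity>
     then {x. \<forall>\<psi>. f \<psi> \<ge> f \<phi> + ereal (dual_apply (\<psi> - \<phi>) x)} else {})"

definition normal_cone ::
    "'a::{real_vector, topological_space} top_dual set \<Rightarrow> 'a top_dual \<Rightarrow> 'a set" where
  "normal_cone A \<phi> =
    (if \<phi> \<in> A then {x. \<forall>\<psi>\<in>A. dual_apply (\<psi> - \<phi>) x \<le> 0} else {})"

definition fin_dim_subspaces :: "'b::real_vector \<Rightarrow> 'b set set" where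
  "fin_dim_subspaces \<phi> = {L. subspace L \<and> (\<exists>B. finite B \<and> L = span B) \<and> \<phi> \<in> L}"

end

theory Submission
  imports Defs
begin

text \<open>
  The inclusions from right to left are direct. For the others, a subgradient \<open>x\<close> of \<open>f = g\<^sup>*\<close> at
  \<open>\<phi>\<close> is tested against finitely many functionals \<open>b\<^sub>1, \<dots>, b\<^sub>n\<close> only. In these
  coordinates, separation and Caratheodory's theorem make \<open>(x, 0)\<close> a limit of convex combinations of
  at most \<open>n + 2\<close> points of the graph of \<open>\<gamma> = g - \<phi> + f \<phi> \<ge> 0\<close>. If \<open>f\<close> is bounded near an
  interior point of its domain in the span of the \<open>b\<^sub>j\<close>, then the products of weights and points stay
  bounded, so along a subsequence every point either converges to a generalized minimizer of \<open>\<gamma>\<close> or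
  has vanishing weight and contributes a normal vector to the domain of \<open>f\<close>.

  For the first formula, the \<open>b\<^sub>j\<close> form a basis of the span of \<open>(L \<inter> dom f) - \<phi>\<close> taken from this
  convex set, which therefore has an interior point in its span. If \<open>f\<close> is continuous at some point,
  then it is bounded on a neighbourhood given by finitely many vectors \<open>a \<in> A\<close>. Hence it is bounded
  along all directions annihilating \<open>A\<close>, so that a dual basis of \<open>A\<close> already provides all the
  coordinates that matter. Only the pairing is used, so no Hahn-Banach theorem is needed.
\<close>

section \<open>Separation, Caratheodory and biorthogonal systems\<close>

text \<open>Bolzano-Weierstrass, refined once per index; finiteness of \<open>Q\<close> makes a
  diagonal argument unnecessary.\<close>

lemma bounded_family_convergent_subsequence:
  fixes x :: "'q \<Rightarrow> nat \<Rightarrow> real"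
  assumes "finite Q" "\<And>q. q \<in> Q \<Longrightarrow> bounded (range (x q))"
  shows "\<exists>r. strict_mono (r :: nat \<Rightarrow> nat) \<and> (\<forall>q\<in>Q. convergent (x q \<circ> r))"
  using assms
proof (induction Q rule: finite_induct)
  case empty
  then show ?case using strict_mono_id by blast
next
  case (insert q Q)
  obtain r where r: "strict_mono (r :: nat \<Rightarrow> nat)" "\<forall>p\<in>Q. convergent (x p \<circ> r)"
    using insert.IH insert.prems by blast
  have "bounded (range (x q \<circ> r))"
    by (rule bounded_subset[OF insert.prems[OF insertI1]]) auto
  then obtain l r' where r': "strict_mono (r' :: nat \<Rightarrow> nat)" "((x q \<circ> r) \<circ> r') \<longlonglongrightarrow> l"
    using bounded_imp_convergent_subsequence by metis
  have "convergent (x p \<circ> (r \<circ> r'))" if "p \<in> insert q Q" for p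
  proof (cases "p = q")
    case True
    then show ?thesis using r' by (auto simp: convergent_def o_assoc)
  next
    case False
    then show ?thesis
      using that r r'(1) convergent_subseq_convergent[of "x p \<circ> r" r'] by (auto simp: o_assoc)
  qed
  then show ?case using r r' strict_mono_o by blast
qed

text \<open>A homogeneous system with more unknowns than equations has a nonzero solution. Scalar
  arrays are used so that the dimension \<open>n\<close> can be a variable.\<close>

lemma exists_linear_dependence:
  fixes \<beta> :: "nat \<Rightarrow> 's \<Rightarrow> real"
  assumes "finite I" "n < card I"
  shows "\<exists>\<mu>. (\<exists>i\<in>I. \<mu> i \<noteq> 0) \<and> (\<forall>j<n. (\<Sum>i\<in>I. \<mu> i * \<beta> j i) = 0)"
  using assms
proof (induction n arbitrary: I \<beta>)
  case 0
  then obtain i where "i \<in> I" by fastforce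
  then show ?case by (intro exI[of _ "\<lambda>_. 1"]) auto
next
  case (Suc n)
  show ?case
  proof (cases "\<forall>i\<in>I. \<beta> n i = 0")
    case True
    obtain \<mu> where "\<exists>i\<in>I. \<mu> i \<noteq> 0" "\<forall>j<n. (\<Sum>i\<in>I. \<mu> i * \<beta> j i) = 0"
      using Suc.IH[of I \<beta>] Suc.prems by auto
    with True show ?thesis
      by (intro exI[of _ \<mu>]) (auto simp: less_Suc_eq)
  next
    case False
    then obtain k where k: "k \<in> I" "\<beta> n k \<noteq> 0" by blast
    let ?J = "I - {k}"
    have "n < card ?J" "finite ?J" using Suc.prems k by auto
    \<comment> \<open>Elimination: equation \<open>n\<close> is solved for the unknown
      \<open>k\<close> and substituted into equation \<open>j\<close>. The value \<open>m\<close>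
      below restores equation \<open>n\<close>.\<close>
    from Suc.IH[OF this(2,1), of "\<lambda>j i. \<beta> j i - \<beta> n i / \<beta> n k * \<beta> j k"]
    obtain \<mu> where \<mu>: "\<exists>i\<in>?J. \<mu> i \<noteq> 0"
      "\<And>j. j < n \<Longrightarrow> (\<Sum>i\<in>?J. \<mu> i * (\<beta> j i - \<beta> n i / \<beta> n k * \<beta> j k)) = 0"
      by blast
    define m where "m = - (\<Sum>i\<in>?J. \<mu> i * \<beta> n i) / \<beta> n k"
    define \<nu> where "\<nu> = \<mu>(k := m)"
    have sum: "(\<Sum>i\<in>I. \<nu> i * \<beta> j i) = m * \<beta> j k + (\<Sum>i\<in>?J. \<mu> i * \<beta> j i)" for j
    proof -
      have "(\<Sum>i\<in>I. \<nu> i * \<beta> j i) = \<nu> k * \<beta> j k + (\<Sum>i\<in>?J. \<nu> i * \<beta> j i)"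
        using Suc.prems(1) k(1) by (rule sum.remove)
      also have "(\<Sum>i\<in>?J. \<nu> i * \<beta> j i) = (\<Sum>i\<in>?J. \<mu> i * \<beta> j i)"
        by (rule sum.cong) (auto simp: \<nu>_def)
      finally show ?thesis by (simp add: \<nu>_def)
    qed
    have "(\<Sum>i\<in>I. \<nu> i * \<beta> j i) = 0" if "j < Suc n" for j
    proof (cases "j = n")
      case True
      then show ?thesis using k(2) by (simp add: sum m_def)
    next
      case False
      have "0 = (\<Sum>i\<in>?J. \<mu> i * \<beta> j i - \<mu> i * \<beta> n i * (\<beta> j k / \<beta> n k))"
        using \<mu>(2)[of j] that False by (simp add: algebra_simps)
      also have "\<dots> = (\<Sum>i\<in>?J. \<mu> i * \<beta> j i) - (\<Sum>i\<in>?J. \<mu> i * \<beta> n i) * (\<beta> j k / \<beta> n k)"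
        by (simp only: sum_subtractf sum_distrib_right)
      finally show ?thesis by (simp add: sum m_def)
    qed
    moreover have "\<exists>i\<in>I. \<nu> i \<noteq> 0" using \<mu>(1) by (auto simp: \<nu>_def)
    ultimately show ?thesis by blast
  qed
qed

lemma conic_caratheodory:
  fixes \<beta> :: "nat \<Rightarrow> 's \<Rightarrow> real"
  assumes "finite I" "\<And>i. i \<in> I \<Longrightarrow> 0 \<le> w i"
  shows "\<exists>J w'. J \<subseteq> I \<and> card J \<le> n \<and> (\<forall>i\<in>J. 0 \<le> w' i) \<and>
    (\<forall>j<n. (\<Sum>i\<in>J. w' i * \<beta> j i) = (\<Sum>i\<in>I. w i * \<beta> j i))"
  using assms
proof (induction "card I" arbitrary: I w rule: less_induct)
  case less
  show ?case
  proof (cases "card I \<le> n")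
    case True
    then show ?thesis using less.prems by (intro exI[of _ I] exI[of _ w]) auto
  next
    case False
    then obtain \<mu>' where \<mu>': "\<exists>i\<in>I. \<mu>' i \<noteq> 0" "\<forall>j<n. (\<Sum>i\<in>I. \<mu>' i * \<beta> j i) = 0"
      using exists_linear_dependence[OF less.prems(1), of n \<beta>] by auto
    \<comment> \<open>The sign is chosen so that some entry is positive; subtracting multiples of
      \<open>\<mu>\<close> then exhausts some weight.\<close>
    obtain \<mu> where \<mu>: "\<exists>i\<in>I. \<mu> i > 0" "\<And>j. j < n \<Longrightarrow> (\<Sum>i\<in>I. \<mu> i * \<beta> j i) = 0"
    proof (cases "\<exists>i\<in>I. \<mu>' i > 0")
      case True
      then show ?thesis using that \<mu>' by blast
    next
      case False
      then have "\<exists>i\<in>I. - \<mu>' i > 0" using \<mu>'(1) by (metis neg_0_less_iff_less linorder_neqE)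
      moreover have "(\<Sum>i\<in>I. - \<mu>' i * \<beta> j i) = 0" if "j < n" for j
        using \<mu>'(2) that by (simp add: sum_negf)
      ultimately show ?thesis using that[of "\<lambda>i. - \<mu>' i"] by blast
    qed
    let ?K = "{i\<in>I. \<mu> i > 0}"
    have fin: "finite ((\<lambda>i. w i / \<mu> i) ` ?K)" "(\<lambda>i. w i / \<mu> i) ` ?K \<noteq> {}"
      using less.prems(1) \<mu>(1) by auto
    \<comment> \<open>The largest step that keeps all weights nonnegative; the index
      \<open>k\<close> attaining the minimum loses its weight.\<close>
    define t where "t = Min ((\<lambda>i. w i / \<mu> i) ` ?K)"
    have "t \<in> (\<lambda>i. w i / \<mu> i) ` ?K" using Min_in[OF fin] by (simp add: t_def)
    then obtain k where k: "k \<in> I" "\<mu> k > 0" "t = w k / \<mu> k" by blast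
    have t0: "0 \<le> t" using k less.prems(2) by simp
    define w1 where "w1 i = w i - t * \<mu> i" for i
    have w1k: "w1 k = 0" using k by (simp add: w1_def)
    have w1: "0 \<le> w1 i" if "i \<in> I" for i
    proof (cases "\<mu> i > 0")
      case True
      then have "t \<le> w i / \<mu> i" unfolding t_def using that less.prems(1) by (intro Min_le) auto
      then show ?thesis using True by (simp add: w1_def field_simps)
    next
      case False
      then have "t * \<mu> i \<le> 0" using t0 by (simp add: mult_nonneg_nonpos)
      then show ?thesis using less.prems(2)[OF that] by (simp add: w1_def)
    qed
    let ?J = "I - {k}"
    have "card ?J < card I" using less.prems(1) k(1) by (rule card_Diff1_less)
    from less.hyps[OF this, of w1] obtain J w' where J: "J \<subseteq> ?J" "card J \<le> n" "\<forall>i\<in>J. 0 \<le> w' i"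
      "\<And>j. j < n \<Longrightarrow> (\<Sum>i\<in>J. w' i * \<beta> j i) = (\<Sum>i\<in>?J. w1 i * \<beta> j i)"
      using less.prems(1) w1 by auto
    have "(\<Sum>i\<in>J. w' i * \<beta> j i) = (\<Sum>i\<in>I. w i * \<beta> j i)" if "j < n" for j
    proof -
      have "(\<Sum>i\<in>?J. w1 i * \<beta> j i) = (\<Sum>i\<in>I. w1 i * \<beta> j i)"
        using sum.remove[OF less.prems(1) k(1), of "\<lambda>i. w1 i * \<beta> j i"] w1k by simp
      also have "\<dots> = (\<Sum>i\<in>I. w i * \<beta> j i) - t * (\<Sum>i\<in>I. \<mu> i * \<beta> j i)"
        by (simp add: w1_def algebra_simps sum_subtractf sum_distrib_left)
      finally show ?thesis using J(4) \<mu>(2) that by simp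
    qed
    then show ?thesis using J by (intro exI[of _ J] exI[of _ w']) auto
  qed
qed

text \<open>The vector \<open>c\<close> is a limit of points of \<open>A\<close> minimizing the
  distance to the origin; it may lie outside \<open>A\<close>. Only variations of \<open>c\<close>
  towards points of \<open>B\<close> are used, which is why \<open>conv\<close> speaks of segments
  from \<open>A\<close> to \<open>B\<close>. In the application \<open>B\<close> consists of the
  generators of the convex hull \<open>A\<close>.\<close>

lemma nearest_point_separation:
  fixes A B :: "('j \<Rightarrow> real) set"
  assumes fin: "finite J" and ne: "A \<noteq> {}" and d0: "0 < d0"
    and far: "\<And>z. z \<in> A \<Longrightarrow> d0 \<le> (\<Sum>j\<in>J. (z j)\<^sup>2)"
    and conv: "\<And>z b t. z \<in> A \<Longrightarrow> b \<in> B \<Longrightarrow> 0 < t \<Longrightarrow> t < 1 \<Longrightarrow> (\<lambda>j. (1 - t) * z j + t * b j) \<in> A"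
  shows "\<exists>c z. (\<forall>l. z l \<in> A) \<and> (\<forall>j\<in>J. (\<lambda>l::nat. z l j) \<longlonglongrightarrow> c j) \<and>
    (\<forall>b\<in>B. d0 \<le> (\<Sum>j\<in>J. c j * b j))"
proof -
  define q :: "('j \<Rightarrow> real) \<Rightarrow> real" where "q z = (\<Sum>j\<in>J. (z j)\<^sup>2)" for z
  define d where "d = Inf (q ` A)"
  have bdd: "bdd_below (q ` A)" using far by (auto simp: bdd_below_def q_def)
  have dq: "d \<le> q z" if "z \<in> A" for z
    unfolding d_def using bdd that by (intro cInf_lower) auto
  have d0d: "d0 \<le> d" unfolding d_def using ne far by (intro cInf_greatest) (auto simp: q_def)
  have "\<exists>z\<in>A. q z < d + 1 / real (Suc l)" for l
  proof -
    have "Inf (q ` A) < d + 1 / real (Suc l)" by (simp add: d_def)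
    then show ?thesis using ne bdd by (subst (asm) cInf_less_iff) auto
  qed
  then obtain a where a: "\<And>l. a l \<in> A" "\<And>l. q (a l) < d + 1 / real (Suc l)" by metis
  have bnd: "bounded (range (\<lambda>l. a l j))" if "j \<in> J" for j
  proof -
    have "\<bar>a l j\<bar> \<le> d + 1 + 1" for l
    proof -
      have "(a l j)\<^sup>2 \<le> q (a l)" unfolding q_def using fin that by (intro member_le_sum) auto
      also have "\<dots> \<le> d + 1"
      proof -
        have "1 / real (Suc l) \<le> 1" by simp
        then show ?thesis using a(2)[of l] by linarith
      qed
      finally have "\<bar>a l j\<bar>\<^sup>2 \<le> d + 1" by simp
      moreover have "\<bar>a l j\<bar> \<le> 1 + \<bar>a l j\<bar>\<^sup>2"
        using zero_le_power2[of "\<bar>a l j\<bar> - 1"] zero_le_power2[of "\<bar>a l j\<bar>"]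
        unfolding power2_diff by (simp del: power2_abs zero_le_power2)
      ultimately show ?thesis by linarith
    qed
    then show ?thesis by (auto simp: bounded_iff)
  qed
  obtain r where r: "strict_mono (r :: nat \<Rightarrow> nat)" "\<forall>j\<in>J. convergent ((\<lambda>l. a l j) \<circ> r)"
    using bounded_family_convergent_subsequence[OF fin, of "\<lambda>j l. a l j"] bnd by blast
  define c where "c j = lim ((\<lambda>l. a l j) \<circ> r)" for j
  have c: "(\<lambda>l. a (r l) j) \<longlonglongrightarrow> c j" if "j \<in> J" for j
    using r(2) that unfolding c_def convergent_LIMSEQ_iff by (auto simp: o_def)
  have qc: "q c \<le> d"
  proof -
    have lim1: "(\<lambda>l. q (a (r l))) \<longlonglongrightarrow> q c"
      unfolding q_def using c by (intro tendsto_sum tendsto_power) auto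
    have lim2: "(\<lambda>l. d + 1 / real (Suc (r l))) \<longlonglongrightarrow> d + 0"
      using LIMSEQ_subseq_LIMSEQ[OF LIMSEQ_Suc[OF lim_1_over_n] r(1)]
      by (intro tendsto_add tendsto_const) (simp add: o_def)
    show ?thesis
      using LIMSEQ_le[OF lim1 lim2] a(2) less_imp_le by (metis add.right_neutral)
  qed
  have "d \<le> (\<Sum>j\<in>J. c j * b j)" if b: "b \<in> B" for b
  proof -
    let ?s = "\<Sum>j\<in>J. c j * b j"
    \<comment> \<open>First variation: the inequality between \<open>d\<close> and the squared norm
      on the segment from \<open>c\<close> to \<open>b\<close>, expanded and divided by
      \<open>t\<close>. Letting \<open>t\<close> tend to 0 leaves twice the claim.\<close>
    have "d * (2 - t) \<le> 2 * (1 - t) * ?s + t * q b" if t: "0 < t" "t < 1" for t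
    proof -
      have "(\<lambda>l. q (\<lambda>j. (1 - t) * a (r l) j + t * b j)) \<longlonglongrightarrow> q (\<lambda>j. (1 - t) * c j + t * b j)"
        unfolding q_def using c by (intro tendsto_intros) auto
      moreover have "d \<le> q (\<lambda>j. (1 - t) * a (r l) j + t * b j)" for l
        using conv[OF a(1) b t] dq by blast
      ultimately have "d \<le> q (\<lambda>j. (1 - t) * c j + t * b j)"
        by (intro LIMSEQ_le_const) auto
      also have "\<dots> = (1 - t)\<^sup>2 * q c + 2 * t * (1 - t) * ?s + t\<^sup>2 * q b"
        unfolding q_def sum_distrib_left sum.distrib[symmetric]
        by (intro sum.cong) (auto simp: power2_eq_square algebra_simps)
      also have "\<dots> \<le> (1 - t)\<^sup>2 * d + 2 * t * (1 - t) * ?s + t\<^sup>2 * q b"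
        using qc by (simp add: mult_left_mono)
      finally have "t * (d * (2 - t)) \<le> t * (2 * (1 - t) * ?s + t * q b)"
        by (simp add: power2_eq_square algebra_simps)
      then show ?thesis using t by simp
    qed
    then have "\<forall>\<^sub>F t in at_right 0. d * (2 - t) \<le> 2 * (1 - t) * ?s + t * q b"
      using eventually_at_right_less[of 0] eventually_at_right_real[of 0 1]
      by (auto elim!: eventually_mono)
    moreover have "((\<lambda>t. d * (2 - t)) \<longlongrightarrow> d * (2 - 0)) (at_right 0)"
      by (intro tendsto_intros)
    moreover have "((\<lambda>t. 2 * (1 - t) * ?s + t * q b) \<longlongrightarrow> 2 * (1 - 0) * ?s + 0 * q b) (at_right 0)"
      by (intro tendsto_intros)
    ultimately have "d * (2 - 0) \<le> 2 * (1 - 0) * ?s + 0 * q b"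
      by (intro tendsto_le[OF trivial_limit_at_right_real]) auto
    then show ?thesis by simp
  qed
  then show ?thesis
    using d0d a(1) c by (intro exI[of _ c] exI[of _ "\<lambda>l. a (r l)"]) fastforce
qed

text \<open>Gram-Schmidt for a pairing, which may be degenerate: the expansion is an identity of
  values of \<open>P\<close>, not of vectors. A general \<open>P\<close> allows both a choice of
  functionals with dual points and a choice of points with dual functionals.\<close>

lemma biorthogonal_system:
  fixes P :: "'v::real_vector \<Rightarrow> 'w::real_vector \<Rightarrow> real"
  assumes P: "bilinear P" and "finite A"
  shows "\<exists>(n::nat) e d. (\<forall>i<n. e i \<in> A) \<and>
    (\<forall>i<n. \<forall>j<n. P (e i) (d j) = (if i = j then 1 else 0)) \<and>
    (\<forall>a\<in>A. \<forall>y. P a y = (\<Sum>i<n. P a (d i) * P (e i) y))"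
  using \<open>finite A\<close>
proof (induction A rule: finite_induct)
  case empty
  show ?case by (intro exI[of _ 0]) auto
next
  case (insert a A)
  then obtain n :: nat and e d where IH': "\<forall>i<n. e i \<in> A"
    "\<forall>i<n. \<forall>j<n. P (e i) (d j) = (if i = j then 1 else 0)"
    "\<forall>b\<in>A. \<forall>y. P b y = (\<Sum>i<n. P b (d i) * P (e i) y)"
    by (elim exE conjE) (rule that)
  note IH = IH'(1)[rule_format] IH'(2)[rule_format] IH'(3)[rule_format]
  have lin: "linear (P x)" for x using P by (simp add: bilinear_def)
  show ?case
  proof (cases "\<forall>y. P a y = (\<Sum>i<n. P a (d i) * P (e i) y)")
    case True
    then have "\<forall>b\<in>insert a A. \<forall>y. P b y = (\<Sum>i<n. P b (d i) * P (e i) y)"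
      using IH'(3) by blast
    then show ?thesis using IH'(1,2) by (intro exI[of _ n] exI[of _ e] exI[of _ d] conjI) blast+
  next
    case False
    then obtain y0 where y0: "P a y0 - (\<Sum>i<n. P a (d i) * P (e i) y0) \<noteq> 0" by auto
    define \<kappa> where "\<kappa> = P a y0 - (\<Sum>i<n. P a (d i) * P (e i) y0)"
    \<comment> \<open>The point \<open>y0\<close> stripped of its components along the old
      \<open>d i\<close> and normalized at \<open>a\<close>. Thus \<open>d'\<close> annihilates all
      of \<open>A\<close> and pairs to 1 with \<open>a\<close>.\<close>
    define d' where "d' = (1 / \<kappa>) *\<^sub>R (y0 - (\<Sum>i<n. P (e i) y0 *\<^sub>R d i))"
    have Pd': "P x d' = (1 / \<kappa>) * (P x y0 - (\<Sum>i<n. P (e i) y0 * P x (d i)))" for x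
      unfolding d'_def
      by (simp add: linear_scale[OF lin] linear_diff[OF lin] linear_sum[OF lin])
    have ed': "P (e j) d' = 0" if "j < n" for j
      using that by (simp add: Pd' IH(2) if_distrib cong: if_cong)
    have ad': "P a d' = 1" using y0 by (simp add: Pd' \<kappa>_def mult.commute)
    have Ad': "P b d' = 0" if "b \<in> A" for b
      using IH(3)[OF that, of d'] ed' by simp
    \<comment> \<open>The old \<open>d i\<close> are corrected by multiples of \<open>d'\<close> so
      that the new vector \<open>a\<close> annihilates them.\<close>
    define D where "D i = (if i < n then d i - P a (d i) *\<^sub>R d' else d')" for i
    define E where "E i = (if i < n then e i else a)" for i
    have PD: "P x (D i) = (if i < n then P x (d i) - P a (d i) * P x d' else P x d')" for x i
      by (simp add: D_def linear_scale[OF lin] linear_diff[OF lin])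
    have "P b y = (\<Sum>i<Suc n. P b (D i) * P (E i) y)" if "b \<in> insert a A" for b y
    proof (cases "b = a")
      case True
      then show ?thesis by (simp add: PD E_def ad')
    next
      case False
      then have "b \<in> A" using that by simp
      then show ?thesis by (subst IH(3)) (simp_all add: PD E_def Ad')
    qed
    moreover have "P (E i) (D j) = (if i = j then 1 else 0)" if "i < Suc n" "j < Suc n" for i j
      using that by (auto simp: PD E_def IH(2) ed' ad' less_Suc_eq)
    moreover have "E i \<in> insert a A" if "i < Suc n" for i
      using that IH(1) by (auto simp: E_def)
    ultimately show ?thesis
      by (intro exI[of _ "Suc n"] exI[of _ E] exI[of _ D] conjI ballI allI impI)
  qed
qed

section \<open>Splitting a subgradient into minimizers and a normal vector\<close>

text \<open>The assumption \<open>sub'\<close> says that every affine minorant of \<gamma> in the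
  coordinates \<open>\<beta>\<close> is at most 0 at \<open>u\<close>. If no convex combination of
  the points of the graph came close to \<open>(u, 0)\<close>, a separating functional would produce
  an affine minorant that is positive at \<open>u\<close>.\<close>

lemma approximate_convex_combination:
  fixes \<beta> :: "nat \<Rightarrow> 's \<Rightarrow> real" and \<gamma> :: "'s \<Rightarrow> real" and u :: "nat \<Rightarrow> real"
  assumes nonneg': "\<forall>s\<in>S. 0 \<le> \<gamma> s"
    and sub': "\<forall>c t. (\<forall>s\<in>S. (\<Sum>j<n. c j * \<beta> j s) - \<gamma> s \<le> t) \<longrightarrow> (\<Sum>j<n. c j * u j) \<le> t"
    and \<eta>: "0 < \<eta>"
  shows "\<exists>I w. finite I \<and> I \<subseteq> S \<and> (\<forall>i\<in>I. 0 \<le> w i) \<and> sum w I = 1 \<and>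
    (\<forall>j<n. \<bar>(\<Sum>i\<in>I. w i * \<beta> j i) - u j\<bar> < \<eta>) \<and> (\<Sum>i\<in>I. w i * \<gamma> i) < \<eta>"
proof (rule ccontr)
  note nonneg = bspec[OF nonneg'] and sub = sub'[THEN spec, THEN spec, THEN mp]
  assume neg: "\<not> ?thesis"
  \<comment> \<open>The graph recentred at \<open>(u, 0)\<close>: coordinates below \<open>n\<close>
    are shifted by \<open>u\<close>, and coordinate \<open>n\<close> holds \<gamma>.\<close>
  define \<delta> where "\<delta> j s = (if j < n then \<beta> j s - u j else \<gamma> s)" for j s
  define A where "A = {z. \<exists>I w. finite I \<and> I \<subseteq> S \<and> (\<forall>i\<in>I. 0 \<le> w i) \<and> sum w I = 1 \<and>
    z = (\<lambda>j. \<Sum>i\<in>I. w i * \<delta> j i)}"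
  define B where "B = (\<lambda>s j. \<delta> j s) ` S"
  have "S \<noteq> {}"
  proof
    assume "S = {}"
    with sub[of "\<lambda>_. 0" "-1"] show False by simp
  qed
  then obtain s0 where "s0 \<in> S" by blast
  then have "(\<lambda>j. \<delta> j s0) \<in> A"
    unfolding A_def by (intro CollectI exI[of _ "{s0}"] exI[of _ "\<lambda>_. 1"]) simp
  then have ne: "A \<noteq> {}" by blast
  have far: "\<eta>\<^sup>2 \<le> (\<Sum>j\<in>{..n}. (z j)\<^sup>2)" if z: "z \<in> A" for z
  proof -
    obtain I w where I: "finite I" "I \<subseteq> S" "\<forall>i\<in>I. 0 \<le> w i" "sum w I = 1"
      "z = (\<lambda>j. \<Sum>i\<in>I. w i * \<delta> j i)"
      using z[unfolded A_def mem_Collect_eq] by (elim exE conjE) (rule that)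
    have zj: "z j = (\<Sum>i\<in>I. w i * \<beta> j i) - u j" if "j < n" for j
    proof -
      have "z j = (\<Sum>i\<in>I. w i * \<beta> j i) - sum w I * u j"
        using that I(5) by (simp add: \<delta>_def right_diff_distrib sum_subtractf sum_distrib_right)
      then show ?thesis using I(4) by simp
    qed
    have zn: "z n = (\<Sum>i\<in>I. w i * \<gamma> i)" using I(5) by (simp add: \<delta>_def)
    have "\<exists>j\<le>n. \<eta> \<le> \<bar>z j\<bar>"
    proof (rule ccontr)
      assume "\<not> ?thesis"
      then have small: "\<bar>z j\<bar> < \<eta>" if "j \<le> n" for j using that by (meson not_le)
      have "\<forall>j<n. \<bar>(\<Sum>i\<in>I. w i * \<beta> j i) - u j\<bar> < \<eta>"
        using small zj by (metis less_imp_le)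
      moreover have "(\<Sum>i\<in>I. w i * \<gamma> i) < \<eta>" using small[of n] zn by simp
      ultimately show False using neg I(1-4) by blast
    qed
    then obtain j where j: "j \<le> n" "\<eta> \<le> \<bar>z j\<bar>" by blast
    have "\<eta>\<^sup>2 \<le> \<bar>z j\<bar>\<^sup>2" using j \<eta> by (intro power_mono) auto
    also have "\<dots> = (z j)\<^sup>2" by simp
    also have "\<dots> \<le> (\<Sum>j\<in>{..n}. (z j)\<^sup>2)" using j by (intro member_le_sum) auto
    finally show ?thesis .
  qed
  have conv: "(\<lambda>j. (1 - t) * z j + t * b j) \<in> A" if z: "z \<in> A" and b: "b \<in> B" and t: "0 < t" "t < 1"
    for z b t
  proof -
    obtain I w where I: "finite I" "I \<subseteq> S" "\<forall>i\<in>I. 0 \<le> w i" "sum w I = 1"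
      "z = (\<lambda>j. \<Sum>i\<in>I. w i * \<delta> j i)"
      using z[unfolded A_def mem_Collect_eq] by (elim exE conjE) (rule that)
    obtain s where s: "s \<in> S" "b = (\<lambda>j. \<delta> j s)" using b unfolding B_def by blast
    \<comment> \<open>Two summands, because \<open>s\<close> may already belong to \<open>I\<close>;
      its weights then add up.\<close>
    define w' where "w' i = (if i \<in> I then (1 - t) * w i else 0) + (if i = s then t else 0)" for i
    have sum: "(\<Sum>i\<in>insert s I. w' i * f i) = (1 - t) * (\<Sum>i\<in>I. w i * f i) + t * f s"
      for f :: "'s \<Rightarrow> real"
    proof -
      have "(\<Sum>i\<in>insert s I. w' i * f i) =
        (\<Sum>i\<in>insert s I. if i \<in> I then (1 - t) * w i * f i else 0) +
        (\<Sum>i\<in>insert s I. if i = s then t * f i else 0)"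
        unfolding sum.distrib[symmetric] by (intro sum.cong) (auto simp: w'_def algebra_simps)
      also have "(\<Sum>i\<in>insert s I. if i \<in> I then (1 - t) * w i * f i else 0) =
          (\<Sum>i\<in>I. (1 - t) * w i * f i)"
        using I(1) by (intro sum.mono_neutral_cong_right) auto
      also have "(\<Sum>i\<in>insert s I. if i = s then t * f i else 0) = t * f s"
        using I(1) by (subst sum.delta) auto
      finally show ?thesis by (simp add: sum_distrib_left mult.assoc)
    qed
    show ?thesis unfolding A_def
    proof (intro CollectI exI[of _ "insert s I"] exI[of _ w'] conjI)
      show "sum w' (insert s I) = 1" using sum[of "\<lambda>_. 1"] I(4) by simp
      show "\<forall>i\<in>insert s I. 0 \<le> w' i" using I(3) t by (auto simp: w'_def)
      show "(\<lambda>j. (1 - t) * z j + t * b j) = (\<lambda>j. \<Sum>i\<in>insert s I. w' i * \<delta> j i)"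
        using I(5) s(2) by (simp add: sum)
    qed (use I s in auto)
  qed
  have "0 < \<eta>\<^sup>2" using \<eta> by simp
  then have "\<exists>c z. (\<forall>l. z l \<in> A) \<and> (\<forall>j\<in>{..n}. (\<lambda>l::nat. z l j) \<longlonglongrightarrow> c j) \<and>
    (\<forall>b\<in>B. \<eta>\<^sup>2 \<le> (\<Sum>j\<in>{..n}. c j * b j))"
    by (rule nearest_point_separation[OF finite_atMost ne]) (fact far, rule conv)
  then obtain c z where cz: "\<forall>l. z l \<in> A" "\<forall>j\<in>{..n}. (\<lambda>l. z l j) \<longlonglongrightarrow> c j"
    "\<forall>b\<in>B. \<eta>\<^sup>2 \<le> (\<Sum>j\<in>{..n}. c j * b j)"
    by blast
  \<comment> \<open>The last coordinate averages nonnegative values of \<gamma>, so the separating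
    functional has a nonnegative slope \<open>c n\<close> there.\<close>
  have "0 \<le> z l n" for l
  proof -
    obtain I w where I: "I \<subseteq> S" "\<forall>i\<in>I. 0 \<le> w i" "z l = (\<lambda>j. \<Sum>i\<in>I. w i * \<delta> j i)"
      using spec[OF cz(1), of l] unfolding A_def by blast
    show ?thesis unfolding I(3) using I(1,2) nonneg by (auto simp: \<delta>_def intro!: sum_nonneg)
  qed
  then have cn: "0 \<le> c n" using bspec[OF cz(2), of n] by (intro LIMSEQ_le_const) auto
  \<comment> \<open>Scaling makes the coefficient of \<gamma> at most 1, which suffices since
    \<gamma> is nonnegative. Dividing by \<open>c n + 1\<close> also covers a vertical hyperplane,
    where \<open>c n\<close> is 0.\<close>
  define T where "T = 1 / (c n + 1)"
  have T: "0 < T" "T * c n \<le> 1" using cn by (auto simp: T_def field_simps)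
  have "(\<Sum>j<n. - T * c j * u j) \<le> (\<Sum>j<n. - T * c j * u j) - T * \<eta>\<^sup>2"
  proof (rule sub, rule ballI)
    fix s assume s: "s \<in> S"
    have "\<eta>\<^sup>2 \<le> (\<Sum>j\<in>{..n}. c j * \<delta> j s)"
      using s by (intro bspec[OF cz(3)]) (auto simp: B_def)
    also have "\<dots> = (\<Sum>j<n. c j * \<beta> j s) - (\<Sum>j<n. c j * u j) + c n * \<gamma> s"
      by (simp add: lessThan_Suc_atMost[symmetric] \<delta>_def right_diff_distrib sum_subtractf)
    finally have "T * \<eta>\<^sup>2 \<le> T * ((\<Sum>j<n. c j * \<beta> j s) - (\<Sum>j<n. c j * u j) + c n * \<gamma> s)"
      using T(1) by simp
    also have "\<dots> = T * (\<Sum>j<n. c j * \<beta> j s) - T * (\<Sum>j<n. c j * u j) + (T * c n) * \<gamma> s"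
      by (simp add: algebra_simps)
    also have "(T * c n) * \<gamma> s \<le> \<gamma> s"
      using mult_right_mono[OF T(2) nonneg[OF s]] by simp
    finally show "(\<Sum>j<n. - T * c j * \<beta> j s) - \<gamma> s \<le> (\<Sum>j<n. - T * c j * u j) - T * \<eta>\<^sup>2"
      by (simp add: sum_distrib_left sum_negf mult.assoc)
  qed
  then have "T * \<eta>\<^sup>2 \<le> 0" by simp
  moreover have "0 < T * \<eta>\<^sup>2" using T(1) \<eta> by simp
  ultimately show False by simp
qed

text \<open>The number of terms no longer depends on \<eta>, so that subsequences can be extracted
  as \<eta> tends to 0.\<close>

lemma approximate_short_convex_combination:
  fixes \<beta> :: "nat \<Rightarrow> 's \<Rightarrow> real" and \<gamma> :: "'s \<Rightarrow> real" and u :: "nat \<Rightarrow> real"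
  assumes nonneg': "\<forall>s\<in>S. 0 \<le> \<gamma> s"
    and sub': "\<forall>c t. (\<forall>s\<in>S. (\<Sum>j<n. c j * \<beta> j s) - \<gamma> s \<le> t) \<longrightarrow> (\<Sum>j<n. c j * u j) \<le> t"
    and \<eta>: "0 < \<eta>"
  shows "\<exists>\<sigma> w. (\<forall>k. \<sigma> k \<in> S) \<and> (\<forall>k. 0 \<le> w k) \<and> (\<Sum>k<n+2. w k) = 1 \<and>
    (\<forall>j<n. \<bar>(\<Sum>k<n+2. w k * \<beta> j (\<sigma> k)) - u j\<bar> < \<eta>) \<and> (\<Sum>k<n+2. w k * \<gamma> (\<sigma> k)) < \<eta>"
proof -
  obtain I w where I: "finite I" "I \<subseteq> S" "\<forall>i\<in>I. 0 \<le> w i" "sum w I = 1"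
    "\<forall>j<n. \<bar>(\<Sum>i\<in>I. w i * \<beta> j i) - u j\<bar> < \<eta>" "(\<Sum>i\<in>I. w i * \<gamma> i) < \<eta>"
    using approximate_convex_combination[OF nonneg' sub' \<eta>]
    by (elim exE conjE) (rule that)
  \<comment> \<open>The \<open>n + 2\<close> rows that must be preserved: the coordinates, then
    \<gamma>, then the constant 1, which keeps the total weight.\<close>
  define \<beta>' where "\<beta>' j i = (if j < n then \<beta> j i else if j = n then \<gamma> i else 1)" for j i
  obtain J w' where J: "J \<subseteq> I" "card J \<le> n + 2" "\<forall>i\<in>J. 0 \<le> w' i"
    "\<And>j. j < n + 2 \<Longrightarrow> (\<Sum>i\<in>J. w' i * \<beta>' j i) = (\<Sum>i\<in>I. w i * \<beta>' j i)"
    using conic_caratheodory[OF I(1), of w "n + 2" \<beta>'] I(3) by blast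
  have sums: "sum w' J = 1" "(\<Sum>i\<in>J. w' i * \<gamma> i) = (\<Sum>i\<in>I. w i * \<gamma> i)"
    using J(4)[of "Suc n"] J(4)[of n] I(4) by (simp_all add: \<beta>'_def)
  have sums\<beta>: "(\<Sum>i\<in>J. w' i * \<beta> j i) = (\<Sum>i\<in>I. w i * \<beta> j i)" if "j < n" for j
    using J(4)[of j] that by (simp add: \<beta>'_def)
  have finJ: "finite J" using J(1) I(1) finite_subset by blast
  have "J \<noteq> {}" using sums(1) by auto
  then obtain s0 where s0: "s0 \<in> J" by blast
  obtain h where h: "bij_betw h {..<card J} J"
    using finJ by (metis ex_bij_betw_nat_finite atLeast0LessThan)
  \<comment> \<open>Enumeration of \<open>J\<close>, padded with the point \<open>s0\<close> at
    weight 0 to reach exactly \<open>n + 2\<close> terms.\<close>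
  define \<sigma> where "\<sigma> k = (if k < card J then h k else s0)" for k
  define v where "v k = (if k < card J then w' (h k) else 0)" for k
  have hJ: "h k \<in> J" if "k < card J" for k using h that by (auto simp: bij_betw_def)
  have sum: "(\<Sum>k<n+2. v k * f (\<sigma> k)) = (\<Sum>i\<in>J. w' i * f i)" for f :: "'s \<Rightarrow> real"
  proof -
    have "(\<Sum>k<n+2. v k * f (\<sigma> k)) = (\<Sum>k<card J. w' (h k) * f (h k))"
      using J(2) by (intro sum.mono_neutral_cong_right) (auto simp: v_def \<sigma>_def)
    also have "\<dots> = (\<Sum>i\<in>J. w' i * f i)" using h by (rule sum.reindex_bij_betw)
    finally show ?thesis .
  qed
  show ?thesis
  proof (intro exI[of _ \<sigma>] exI[of _ v] conjI allI impI)
    show "\<sigma> k \<in> S" for k using hJ s0 J(1) I(2) by (auto simp: \<sigma>_def)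
    show "0 \<le> v k" for k using hJ J(3) by (auto simp: v_def)
    show "(\<Sum>k<n+2. v k) = 1" using sum[of "\<lambda>_. 1"] sums(1) by simp
    show "\<bar>(\<Sum>k<n+2. v k * \<beta> j (\<sigma> k)) - u j\<bar> < \<eta>" if "j < n" for j
      using I(5) that by (simp only: sum sums\<beta>)
    show "(\<Sum>k<n+2. v k * \<gamma> (\<sigma> k)) < \<eta>"
      using I(6) by (simp only: sum sums(2))
  qed
qed

text \<open>
  The last assumption bounds the products of weights and points. A point whose weight stays positive
  in the limit converges to a minimizer of \<open>\<gamma>\<close>; the others only contribute a recession part \<open>v\<close>.
\<close>

lemma minimizer_recession_decomposition:
  fixes \<beta> :: "nat \<Rightarrow> 's \<Rightarrow> real" and \<gamma> :: "'s \<Rightarrow> real" and u p :: "nat \<Rightarrow> real"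
  assumes nonneg': "\<forall>s\<in>S. 0 \<le> \<gamma> s"
    and sub': "\<forall>c t. (\<forall>s\<in>S. (\<Sum>j<n. c j * \<beta> j s) - \<gamma> s \<le> t) \<longrightarrow> (\<Sum>j<n. c j * u j) \<le> t"
    and \<rho>: "0 < \<rho>"
    and interior': "\<forall>s\<in>S. (\<Sum>j<n. p j * \<beta> j s) + \<rho> * (\<Sum>j<n. \<bar>\<beta> j s\<bar>) \<le> M + \<gamma> s"
  shows "\<exists>K lam w v. finite (K :: nat set) \<and> (\<forall>k\<in>K. 0 \<le> lam k) \<and> sum lam K = 1 \<and>
    (\<forall>j<n. u j = (\<Sum>k\<in>K. lam k * w k j) + v j) \<and>
    (\<forall>k\<in>K. \<exists>\<sigma> :: nat \<Rightarrow> 's. (\<forall>l. \<sigma> l \<in> S) \<and> (\<forall>j<n. (\<lambda>l. \<beta> j (\<sigma> l)) \<longlonglongrightarrow> w k j) \<and>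
      (\<lambda>l. \<gamma> (\<sigma> l)) \<longlonglongrightarrow> 0) \<and>
    (\<forall>c t. (\<forall>s\<in>S. (\<Sum>j<n. c j * \<beta> j s) - \<gamma> s \<le> t) \<longrightarrow> (\<Sum>j<n. c j * v j) \<le> (0::real))"
proof -
  note nonneg = bspec[OF nonneg'] and sub = sub'[THEN spec, THEN spec, THEN mp]
    and interior = bspec[OF interior']
  let ?N = "n + 2"
  define Q where "Q l \<sigma> w \<longleftrightarrow> (\<forall>k. \<sigma> k \<in> S) \<and> (\<forall>k. 0 \<le> w k) \<and> (\<Sum>k<?N. w k) = 1 \<and>
    (\<forall>j<n. \<bar>(\<Sum>k<?N. w k * \<beta> j (\<sigma> k)) - u j\<bar> < 1 / real (Suc l)) \<and>
    (\<Sum>k<?N. w k * \<gamma> (\<sigma> k)) < 1 / real (Suc l)" for l \<sigma> w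
  have "\<exists>\<sigma> w. Q l \<sigma> w" for l
    unfolding Q_def by (rule approximate_short_convex_combination[OF nonneg' sub']) auto
  then obtain s w where Q: "\<And>l. Q l (s l) (w l)" by metis
  have s: "\<And>l k. s l k \<in> S" and w: "\<And>l k. 0 \<le> w l k"
    and w1: "\<And>l. (\<Sum>k<?N. w l k) = 1"
    and wu: "\<And>l j. j < n \<Longrightarrow> \<bar>(\<Sum>k<?N. w l k * \<beta> j (s l k)) - u j\<bar> < 1 / real (Suc l)"
    and w\<gamma>: "\<And>l. (\<Sum>k<?N. w l k * \<gamma> (s l k)) < 1 / real (Suc l)"
    using Q unfolding Q_def by blast+
  have inv0: "(\<lambda>l. 1 / real (Suc l)) \<longlonglongrightarrow> 0"
    using LIMSEQ_Suc[OF lim_1_over_n] by simp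
  have wle1: "w l k \<le> 1" if "k < ?N" for l k
    using member_le_sum[of k "{..<?N}" "w l"] that w w1[of l] by auto
  have w\<gamma>_le: "w l k * \<gamma> (s l k) \<le> 1 / real (Suc l)" if "k < ?N" for l k
    using member_le_sum[of k "{..<?N}" "\<lambda>k. w l k * \<gamma> (s l k)"] that w nonneg[OF s] w\<gamma>[of l] by auto
  \<comment> \<open>Averaging \<open>interior\<close> with the weights \<open>w l\<close> gives this
    bound: the averaged coordinates are within 1 of \<open>u\<close>, and the average of \<gamma> is
    below 1.\<close>
  define C where "C = (\<bar>M\<bar> + 1 + (\<Sum>j<n. \<bar>p j\<bar> * (\<bar>u j\<bar> + 1))) / \<rho>"
  have w\<beta>_le: "\<bar>w l k * \<beta> j (s l k)\<bar> \<le> C" if k: "k < ?N" and j: "j < n" for l k j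
  proof -
    have le1: "1 / real (Suc l) \<le> 1" by simp
    have "(\<Sum>j<n. p j * (\<Sum>k<?N. w l k * \<beta> j (s l k))) + \<rho> * (\<Sum>k<?N. w l k * (\<Sum>j<n. \<bar>\<beta> j (s l k)\<bar>)) =
      (\<Sum>k<?N. w l k * ((\<Sum>j<n. p j * \<beta> j (s l k)) + \<rho> * (\<Sum>j<n. \<bar>\<beta> j (s l k)\<bar>)))"
      unfolding distrib_left sum.distrib sum_distrib_left
      by (subst sum.swap) (simp add: mult_ac)
    also have "\<dots> \<le> (\<Sum>k<?N. w l k * (M + \<gamma> (s l k)))"
      using w interior[OF s] by (intro sum_mono mult_left_mono) auto
    also have "\<dots> = M * (\<Sum>k<?N. w l k) + (\<Sum>k<?N. w l k * \<gamma> (s l k))"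
      unfolding distrib_left sum.distrib sum_distrib_left by (simp add: mult_ac)
    also have "\<dots> \<le> \<bar>M\<bar> + 1" unfolding w1 using w\<gamma>[of l] le1 by linarith
    finally have 1: "\<rho> * (\<Sum>k<?N. w l k * (\<Sum>j<n. \<bar>\<beta> j (s l k)\<bar>)) \<le>
      \<bar>M\<bar> + 1 - (\<Sum>j<n. p j * (\<Sum>k<?N. w l k * \<beta> j (s l k)))" by simp
    have "- (\<Sum>j<n. p j * (\<Sum>k<?N. w l k * \<beta> j (s l k))) \<le> (\<Sum>j<n. \<bar>p j\<bar> * (\<bar>u j\<bar> + 1))"
      unfolding sum_negf[symmetric]
    proof (rule sum_mono)
      fix j assume "j \<in> {..<n}"
      then have "\<bar>\<Sum>k<?N. w l k * \<beta> j (s l k)\<bar> \<le> \<bar>u j\<bar> + 1" using wu[of j l] le1 unfolding lessThan_iff by linarith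
      then have "\<bar>p j\<bar> * \<bar>\<Sum>k<?N. w l k * \<beta> j (s l k)\<bar> \<le> \<bar>p j\<bar> * (\<bar>u j\<bar> + 1)"
        by (intro mult_left_mono) auto
      then show "- (p j * (\<Sum>k<?N. w l k * \<beta> j (s l k))) \<le> \<bar>p j\<bar> * (\<bar>u j\<bar> + 1)"
        unfolding abs_mult[symmetric] by linarith
    qed
    with 1 have "\<rho> * (\<Sum>k<?N. w l k * (\<Sum>j<n. \<bar>\<beta> j (s l k)\<bar>)) \<le> \<rho> * C"
      using \<rho> by (simp add: C_def)
    then have "(\<Sum>k<?N. w l k * (\<Sum>j<n. \<bar>\<beta> j (s l k)\<bar>)) \<le> C" using \<rho> by simp
    moreover have "w l k * (\<Sum>j<n. \<bar>\<beta> j (s l k)\<bar>) \<le> (\<Sum>k<?N. w l k * (\<Sum>j<n. \<bar>\<beta> j (s l k)\<bar>))"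
      using k w by (intro member_le_sum[of k]) (auto intro: mult_nonneg_nonneg sum_nonneg)
    moreover have "w l k * \<bar>\<beta> j (s l k)\<bar> \<le> w l k * (\<Sum>j<n. \<bar>\<beta> j (s l k)\<bar>)"
      using j w by (intro mult_left_mono member_le_sum) auto
    ultimately show ?thesis using w by (simp add: abs_mult)
  qed
  \<comment> \<open>Index \<open>n\<close> carries the weight itself, so one extraction serves the
    weights and the weighted coordinates.\<close>
  define x where "x = (\<lambda>(k, j) l. w l k * (if j < n then \<beta> j (s l k) else 1))"
  have "bounded (range (x q))" if mem: "q \<in> {..<?N} \<times> {..n}" for q
  proof -
    obtain k j where q: "q = (k, j)" "k < ?N" "j \<le> n" using mem by auto
    have "\<bar>x q l\<bar> \<le> max C 1" for l
      using w\<beta>_le[OF q(2), of j l] wle1[OF q(2), of l] w[of l k] by (auto simp: x_def q(1))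
    then show ?thesis by (auto simp: bounded_iff)
  qed
  then obtain r where r: "strict_mono (r :: nat \<Rightarrow> nat)"
    "\<And>q. q \<in> {..<?N} \<times> {..n} \<Longrightarrow> convergent (x q \<circ> r)"
    using bounded_family_convergent_subsequence[of "{..<?N} \<times> {..n}" x] by auto
  define V where "V k j = lim (x (k, j) \<circ> r)" for k j
  have xV: "(x (k, j) \<circ> r) \<longlonglongrightarrow> V k j" if "k < ?N" "j \<le> n" for k j
    using r(2)[of "(k, j)"] that unfolding V_def convergent_LIMSEQ_iff by auto
  define lam where "lam k = V k n" for k
  have lam: "(\<lambda>l. w (r l) k) \<longlonglongrightarrow> lam k" if "k < ?N" for k
    using xV[OF that, of n] by (simp add: x_def o_def lam_def)
  have V: "(\<lambda>l. w (r l) k * \<beta> j (s (r l) k)) \<longlonglongrightarrow> V k j" if "k < ?N" "j < n" for k j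
    using xV[OF that(1), of j] that(2) by (simp add: x_def o_def)
  have inv0r: "(\<lambda>l. 1 / real (Suc (r l))) \<longlonglongrightarrow> 0"
    using LIMSEQ_subseq_LIMSEQ[OF inv0 r(1)] by (simp add: o_def)
  have w\<gamma>0: "(\<lambda>l. w (r l) k * \<gamma> (s (r l) k)) \<longlonglongrightarrow> 0" if "k < ?N" for k
    using w nonneg[OF s] w\<gamma>_le[OF that]
    by (intro tendsto_sandwich[OF _ _ tendsto_const inv0r] always_eventually) auto
  have lam0: "0 \<le> lam k" if "k < ?N" for k
    using lam[OF that] w by (intro LIMSEQ_le_const) auto
  have lam1: "(\<Sum>k<?N. lam k) = 1"
  proof -
    have "(\<lambda>l. \<Sum>k<?N. w (r l) k) \<longlonglongrightarrow> (\<Sum>k<?N. lam k)"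
      using lam by (intro tendsto_sum) auto
    then show ?thesis unfolding w1 by (simp add: LIMSEQ_const_iff)
  qed
  have uV: "u j = (\<Sum>k<?N. V k j)" if "j < n" for j
  proof -
    have "(\<lambda>l. \<Sum>k<?N. w (r l) k * \<beta> j (s (r l) k)) \<longlonglongrightarrow> (\<Sum>k<?N. V k j)"
      using V that by (intro tendsto_sum) auto
    moreover have "(\<lambda>l. \<Sum>k<?N. w (r l) k * \<beta> j (s (r l) k)) \<longlonglongrightarrow> u j"
    proof (rule LIM_zero_cancel, rule tendsto_rabs_zero_cancel, rule Lim_null_comparison[OF _ inv0r])
      show "\<forall>\<^sub>F l in sequentially. norm \<bar>(\<Sum>k<?N. w (r l) k * \<beta> j (s (r l) k)) - u j\<bar> \<le> 1 / real (Suc (r l))"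
        unfolding real_norm_def abs_abs using wu[OF that] by (intro always_eventually allI less_imp_le)
    qed
    ultimately show ?thesis using LIMSEQ_unique by blast
  qed
  \<comment> \<open>Indices whose weight survives in the limit; the weighted limits of all other
    indices are collected in \<open>v\<close>.\<close>
  define K where "K = {k\<in>{..<?N}. 0 < lam k}"
  define v where "v j = (\<Sum>k\<in>{..<?N} - K. V k j)" for j
  have split: "(\<Sum>k<?N. f k) = sum f K + (\<Sum>k\<in>{..<?N} - K. f k)" for f :: "nat \<Rightarrow> real"
    by (subst add.commute, rule sum.subset_diff) (auto simp: K_def)
  have lamK: "lam k = 0" if "k \<in> {..<?N} - K" for k
    using that lam0[of k] by (auto simp: K_def)
  show ?thesis
  proof (rule exI[of _ K], rule exI[of _ lam], rule exI[of _ "\<lambda>k j. V k j / lam k"],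
      rule exI[of _ v], intro conjI ballI allI impI)
    show "finite K" by (simp add: K_def)
    show "0 \<le> lam k" if "k \<in> K" for k using that by (simp add: K_def)
    show "sum lam K = 1" using lam1 split[of lam] lamK by simp
    show "u j = (\<Sum>k\<in>K. lam k * (V k j / lam k)) + v j" if "j < n" for j
      unfolding uV[OF that] split[of "\<lambda>k. V k j"] v_def
      by (intro arg_cong2[of _ _ _ _ "(+)"] sum.cong) (auto simp: K_def)
    show "\<exists>\<sigma> :: nat \<Rightarrow> 's. (\<forall>l. \<sigma> l \<in> S) \<and> (\<forall>j<n. (\<lambda>l. \<beta> j (\<sigma> l)) \<longlonglongrightarrow> V k j / lam k) \<and>
      (\<lambda>l. \<gamma> (\<sigma> l)) \<longlonglongrightarrow> 0" if "k \<in> K" for k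
    proof (intro exI[of _ "\<lambda>l. s (r l) k"] conjI allI impI)
      have k: "k < ?N" "0 < lam k" using that by (auto simp: K_def)
      \<comment> \<open>With a positive limiting weight, the convergent products can be divided by
        the weights, so the points themselves converge in coordinates.\<close>
      have ev: "\<forall>\<^sub>F l in sequentially. w (r l) k > 0" using order_tendstoD(1)[OF lam] k by blast
      show "s (r l) k \<in> S" for l by (rule s)
      show "(\<lambda>l. \<beta> j (s (r l) k)) \<longlonglongrightarrow> V k j / lam k" if "j < n" for j
        using ev k that
        by (intro Lim_transform_eventually[OF tendsto_divide[OF V lam]]) (auto elim!: eventually_mono)
      have "(\<lambda>l. \<gamma> (s (r l) k)) \<longlonglongrightarrow> 0 / lam k"
        using ev k
        by (intro Lim_transform_eventually[OF tendsto_divide[OF w\<gamma>0 lam]]) (auto elim!: eventually_mono)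
      then show "(\<lambda>l. \<gamma> (s (r l) k)) \<longlonglongrightarrow> 0" by simp
    qed
    show "(\<Sum>j<n. c j * v j) \<le> 0" if ct: "\<forall>s\<in>S. (\<Sum>j<n. c j * \<beta> j s) - \<gamma> s \<le> t" for c t
    proof -
      \<comment> \<open>The bound \<open>ct\<close> multiplied by a weight tending to 0: both
        \<open>t\<close> and \<gamma> disappear in the limit.\<close>
      have "(\<Sum>j<n. c j * V k j) \<le> 0" if k: "k \<in> {..<?N} - K" for k
      proof -
        have kN: "k < ?N" using k by simp
        have "(\<lambda>l. \<Sum>j<n. c j * (w (r l) k * \<beta> j (s (r l) k))) \<longlonglongrightarrow> (\<Sum>j<n. c j * V k j)"
          using V[OF kN] by (intro tendsto_intros) auto
        moreover have "(\<lambda>l. w (r l) k * t + w (r l) k * \<gamma> (s (r l) k)) \<longlonglongrightarrow> lam k * t + 0"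
          using kN by (intro tendsto_intros lam w\<gamma>0)
        moreover have "(\<Sum>j<n. c j * (w (r l) k * \<beta> j (s (r l) k))) \<le>
            w (r l) k * t + w (r l) k * \<gamma> (s (r l) k)" for l
        proof -
          have "(\<Sum>j<n. c j * (w (r l) k * \<beta> j (s (r l) k))) = w (r l) k * (\<Sum>j<n. c j * \<beta> j (s (r l) k))"
            by (simp add: sum_distrib_left mult_ac)
          also have "\<dots> \<le> w (r l) k * (t + \<gamma> (s (r l) k))"
            using bspec[OF ct s[of "r l" k]] w by (intro mult_left_mono) auto
          finally show ?thesis by (simp add: distrib_left)
        qed
        ultimately have "(\<Sum>j<n. c j * V k j) \<le> lam k * t + 0"
          by (intro LIMSEQ_le) auto
        then show ?thesis using lamK[OF k] by simp
      qed
      then have "(\<Sum>k\<in>{..<?N} - K. \<Sum>j<n. c j * V k j) \<le> 0" by (rule sum_nonpos)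
      also have "(\<Sum>k\<in>{..<?N} - K. \<Sum>j<n. c j * V k j) = (\<Sum>j<n. c j * v j)"
        unfolding v_def sum_distrib_left by (rule sum.swap)
      finally show ?thesis .
    qed
  qed
qed

section \<open>Conjugates and subgradients\<close>

lemma dual_apply_linear_simps:
  "dual_apply \<phi> (x + y) = dual_apply \<phi> x + dual_apply \<phi> y"
  "dual_apply \<phi> (x - y) = dual_apply \<phi> x - dual_apply \<phi> y"
  "dual_apply \<phi> (c *\<^sub>R x) = c * dual_apply \<phi> x"
  "dual_apply \<phi> (\<Sum>i\<in>I. h i) = (\<Sum>i\<in>I. dual_apply \<phi> (h i))"
  using linear_add[OF linear_dual_apply] linear_diff[OF linear_dual_apply]
    linear_scale[OF linear_dual_apply] linear_sum[OF linear_dual_apply] by auto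

lemma linear_dual_apply_left: "linear (\<lambda>\<phi>. dual_apply \<phi> x)"
  by (auto intro: linearI)

lemma dual_apply_sum: "dual_apply (\<Sum>i\<in>I. h i) x = (\<Sum>i\<in>I. dual_apply (h i) x)"
  using linear_sum[OF linear_dual_apply_left] .

lemma bilinear_dual_apply: "bilinear dual_apply" "bilinear (\<lambda>x \<phi>. dual_apply \<phi> x)"
  by (simp_all add: bilinear_def linear_dual_apply linear_dual_apply_left)

lemma conjugate_ge: "ereal (dual_apply \<psi> s) - g s \<le> conjugate g \<psi>"
  unfolding conjugate_def by (rule SUP_upper) simp

lemma conjugate_le_iff:
  assumes "\<forall>x. g x \<noteq> -\<infinity>"
  shows "conjugate g \<psi> \<le> ereal t \<longleftrightarrow> (\<forall>s. g s \<noteq> \<infinity> \<longrightarrow> dual_apply \<psi> s - real_of_ereal (g s) \<le> t)"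
proof -
  have "ereal (dual_apply \<psi> s) - g s \<le> ereal t \<longleftrightarrow>
    (g s \<noteq> \<infinity> \<longrightarrow> dual_apply \<psi> s - real_of_ereal (g s) \<le> t)" for s
    using assms[rule_format, of s] by (cases "g s") auto
  then show ?thesis unfolding conjugate_def SUP_le_iff by simp
qed

text \<open>Quantifying over real upper bounds \<open>t\<close> of the conjugate makes the case of
  an infinite value vacuous and leaves only real arithmetic.\<close>

lemma mem_dual_subdiff_iff:
  assumes "conjugate g \<phi> = ereal \<alpha>"
  shows "x \<in> dual_subdiff (conjugate g) \<phi> \<longleftrightarrow>
    (\<forall>\<psi> t. conjugate g \<psi> \<le> ereal t \<longrightarrow> \<alpha> + dual_apply (\<psi> - \<phi>) x \<le> t)"
proof -
  have "conjugate g \<psi> \<ge> ereal \<alpha> + ereal (dual_apply (\<psi> - \<phi>) x) \<longleftrightarrow>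
    (\<forall>t. conjugate g \<psi> \<le> ereal t \<longrightarrow> \<alpha> + dual_apply (\<psi> - \<phi>) x \<le> t)" (is "?l \<longleftrightarrow> ?r") for \<psi>
  proof
    assume ?l
    show ?r
    proof (intro allI impI)
      fix t assume "conjugate g \<psi> \<le> ereal t"
      with \<open>?l\<close> have "ereal \<alpha> + ereal (dual_apply (\<psi> - \<phi>) x) \<le> ereal t" by (rule order_trans)
      then show "\<alpha> + dual_apply (\<psi> - \<phi>) x \<le> t" by simp
    qed
  next
    assume ?r
    then show ?l by - (rule ereal_le_real, simp)
  qed
  then show ?thesis using assms by (auto simp: dual_subdiff_def)
qed

lemma mem_normal_cone_iff:
  "x \<in> normal_cone A \<phi> \<longleftrightarrow> \<phi> \<in> A \<and> (\<forall>\<psi>\<in>A. dual_apply (\<psi> - \<phi>) x \<le> 0)"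
  by (simp add: normal_cone_def)

text \<open>By the definition of the conjugate, the inverse approximate subdifferential is a
  sublevel set of the Fenchel-Young gap \<open>g - \<phi> + \<alpha>\<close>, the function called
  \<gamma> above.\<close>

lemma eps_subdiff_inverse_conjugate:
  assumes g: "\<forall>x. g x \<noteq> -\<infinity>" and \<alpha>: "conjugate g \<phi> = ereal \<alpha>"
  shows "x \<in> set_valued_inv (eps_subdiff \<epsilon> g) \<phi> \<longleftrightarrow>
    g x \<noteq> \<infinity> \<and> real_of_ereal (g x) - dual_apply \<phi> x + \<alpha> \<le> \<epsilon>"
proof (cases "g x = \<infinity>")
  case True
  then show ?thesis by (simp add: set_valued_inv_def eps_subdiff_def)
next
  case False
  then obtain r where r: "g x = ereal r" using g by (cases "g x") auto
  have "\<phi> \<in> eps_subdiff \<epsilon> g x \<longleftrightarrow> (\<forall>y. g y \<ge> ereal r + ereal (dual_apply \<phi> (y - x)) - ereal \<epsilon>)"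
    using r by (simp add: eps_subdiff_def)
  also have "\<dots> \<longleftrightarrow> (\<forall>y. g y \<noteq> \<infinity> \<longrightarrow> dual_apply \<phi> y - real_of_ereal (g y) \<le> dual_apply \<phi> x - r + \<epsilon>)"
  proof (rule all_cong1)
    fix y
    show "g y \<ge> ereal r + ereal (dual_apply \<phi> (y - x)) - ereal \<epsilon> \<longleftrightarrow>
      (g y \<noteq> \<infinity> \<longrightarrow> dual_apply \<phi> y - real_of_ereal (g y) \<le> dual_apply \<phi> x - r + \<epsilon>)"
      using g[rule_format, of y] by (cases "g y") (auto simp: dual_apply_linear_simps)
  qed
  also have "\<dots> \<longleftrightarrow> \<alpha> \<le> dual_apply \<phi> x - r + \<epsilon>"
    using conjugate_le_iff[OF g, of \<phi> "dual_apply \<phi> x - r + \<epsilon>"] \<alpha> by simp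
  finally show ?thesis using r by (auto simp: set_valued_inv_def)
qed

lemma dual_subdiff_eq_empty: "conjugate g \<phi> = \<infinity> \<Longrightarrow> dual_subdiff (conjugate g) \<phi> = {}"
  by (simp add: dual_subdiff_def)

lemma normal_cone_eq_empty: "conjugate g \<phi> = \<infinity> \<Longrightarrow> normal_cone (L \<inter> edom (conjugate g)) \<phi> = {}"
  "conjugate g \<phi> = \<infinity> \<Longrightarrow> normal_cone (edom (conjugate g)) \<phi> = {}"
  by (simp_all add: normal_cone_def edom_def)

lemma finite_or_infinite_conjugate:
  assumes "proper (conjugate g)"
  obtains "conjugate g \<phi> = \<infinity>" | \<alpha> where "conjugate g \<phi> = ereal \<alpha>"
  using assms unfolding proper_def by (cases "conjugate g \<phi>") auto

text \<open>It suffices to test on the generating sets, as eventual membership passes to finite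
  intersections and to unions.\<close>

lemma limitin_weak_topology:
  assumes "\<And>\<psi>. (\<lambda>l. dual_apply \<psi> (\<sigma> l)) \<longlonglongrightarrow> dual_apply \<psi> x"
  shows "limitin weak_topology \<sigma> x sequentially"
proof -
  have "x \<in> U \<longrightarrow> (\<forall>\<^sub>F l in sequentially. \<sigma> l \<in> U)"
    if "generate_topology_on {dual_apply \<phi> -` V | \<phi> V. open V} U" for U :: "'a set"
    using that
  proof (induction rule: generate_topology_on.induct)
    case (Int a b)
    then show ?case by (auto intro: eventually_conj)
  next
    case (UN K)
    show ?case
    proof
      assume "x \<in> \<Union>K"
      then obtain k where "k \<in> K" "x \<in> k" by blast
      then have "\<forall>\<^sub>F l in sequentially. \<sigma> l \<in> k" using UN by blast
      then show "\<forall>\<^sub>F l in sequentially. \<sigma> l \<in> \<Union>K"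
        using \<open>k \<in> K\<close> by (auto elim!: eventually_mono)
    qed
  next
    case (Basis s)
    then obtain \<phi> V where s: "s = dual_apply \<phi> -` V" "open V" by blast
    show ?case using topological_tendstoD[OF assms[of \<phi>] s(2)] by (auto simp: s(1))
  qed auto
  then show ?thesis
    by (simp add: limitin_def) (simp add: weak_topology_def openin_topology_generated_by_iff)
qed

lemma limitin_imp_in_closure_of:
  assumes "limitin T \<sigma> x sequentially" "\<forall>\<^sub>F l in sequentially. \<sigma> l \<in> S"
  shows "x \<in> T closure_of S"
  unfolding in_closure_of
proof (intro conjI allI impI)
  show "x \<in> topspace T" using assms(1) by (simp add: limitin_def)
  fix U assume "x \<in> U \<and> openin T U"
  then have "\<forall>\<^sub>F l in sequentially. \<sigma> l \<in> U" using assms(1) by (simp add: limitin_def)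
  then have "\<forall>\<^sub>F l in sequentially. \<sigma> l \<in> S \<and> \<sigma> l \<in> U" using assms(2) by (rule eventually_conj[rotated])
  then show "\<exists>y. y \<in> S \<and> y \<in> U" using eventually_happens trivial_limit_sequentially by blast
qed

lemma continuous_map_weak_topology: "continuous_map weak_topology euclideanreal (dual_apply \<psi>)"
proof -
  have "openin weak_topology (dual_apply \<psi> -` V)" if "open V" for V
    unfolding weak_topology_def using that by (intro topology_generated_by_Basis) blast
  then show ?thesis by (auto simp: continuous_map_def vimage_def)
qed

text \<open>The abstract decomposition with coordinates \<open>b j\<close> and \<gamma> the
  Fenchel-Young gap. In the last conclusion \<open>\<psi> - \<phi>\<close> has to be a combination
  of the \<open>b j\<close> only on the domain of \<open>g\<close>, because in the continuous case
  such a representation is available only there.\<close>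

lemma subgradient_decomposition:
  fixes g :: "'a::{real_vector, topological_space} \<Rightarrow> ereal" and n :: nat
  assumes g: "\<forall>x. g x \<noteq> -\<infinity>" and \<alpha>: "conjugate g \<phi> = ereal \<alpha>"
    and x: "x \<in> dual_subdiff (conjugate g) \<phi>" and \<rho>: "0 < \<rho>"
    and interior: "\<forall>s. g s \<noteq> \<infinity> \<longrightarrow>
      (\<Sum>j<n. p j * dual_apply (b j) s) + \<rho> * (\<Sum>j<n. \<bar>dual_apply (b j) s\<bar>) \<le>
      M + (real_of_ereal (g s) - dual_apply \<phi> s + \<alpha>)"
  obtains K :: "nat set" and lam w v where "finite K" "\<forall>k\<in>K. 0 \<le> lam k" "sum lam K = 1"
    "\<forall>j<n. dual_apply (b j) x = (\<Sum>k\<in>K. lam k * w k j) + v j"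
    "\<forall>k\<in>K. \<exists>\<sigma>. (\<forall>l. g (\<sigma> l) \<noteq> \<infinity>) \<and> (\<forall>j<n. (\<lambda>l. dual_apply (b j) (\<sigma> l)) \<longlonglongrightarrow> w k j) \<and>
      (\<lambda>l::nat. real_of_ereal (g (\<sigma> l)) - dual_apply \<phi> (\<sigma> l) + \<alpha>) \<longlonglongrightarrow> 0"
    "\<And>c \<psi>. conjugate g \<psi> < \<infinity> \<Longrightarrow>
      \<forall>s. g s \<noteq> \<infinity> \<longrightarrow> dual_apply (\<psi> - \<phi>) s = (\<Sum>j<n. c j * dual_apply (b j) s) \<Longrightarrow>
      (\<Sum>j<n. c j * v j) \<le> (0::real)"
proof -
  let ?S = "{s. g s \<noteq> \<infinity>}"
  let ?\<gamma> = "\<lambda>s. real_of_ereal (g s) - dual_apply \<phi> s + \<alpha>"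
  let ?\<beta> = "\<lambda>j. dual_apply (b j)"
  have 1: "\<forall>s\<in>?S. 0 \<le> ?\<gamma> s"
    using conjugate_le_iff[OF g, of \<phi> \<alpha>] \<alpha> by (auto simp: algebra_simps)
  have 2: "\<forall>c t. (\<forall>s\<in>?S. (\<Sum>j<n. c j * ?\<beta> j s) - ?\<gamma> s \<le> t) \<longrightarrow> (\<Sum>j<n. c j * ?\<beta> j x) \<le> t"
  proof (intro allI impI)
    fix c t assume ct: "\<forall>s\<in>?S. (\<Sum>j<n. c j * ?\<beta> j s) - ?\<gamma> s \<le> t"
    \<comment> \<open>The subgradient inequality at this functional is exactly the domination
      condition for the coefficients \<open>c\<close>.\<close>
    let ?\<psi> = "\<phi> + (\<Sum>j<n. c j *\<^sub>R b j)"
    have "conjugate g ?\<psi> \<le> ereal (\<alpha> + t)"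
      unfolding conjugate_le_iff[OF g] using ct by (auto simp: dual_apply_sum algebra_simps)
    then have "\<alpha> + dual_apply (?\<psi> - \<phi>) x \<le> \<alpha> + t"
      using x mem_dual_subdiff_iff[OF \<alpha>] by blast
    then show "(\<Sum>j<n. c j * ?\<beta> j x) \<le> t" by (simp add: dual_apply_sum)
  qed
  have 3: "\<forall>s\<in>?S. (\<Sum>j<n. p j * ?\<beta> j s) + \<rho> * (\<Sum>j<n. \<bar>?\<beta> j s\<bar>) \<le> M + ?\<gamma> s"
    using interior by simp
  obtain K :: "nat set" and lam w v where K: "finite K" "\<forall>k\<in>K. 0 \<le> lam k" "sum lam K = 1"
    "\<forall>j<n. ?\<beta> j x = (\<Sum>k\<in>K. lam k * w k j) + v j"
    "\<forall>k\<in>K. \<exists>\<sigma> :: nat \<Rightarrow> 'a. (\<forall>l. \<sigma> l \<in> ?S) \<and> (\<forall>j<n. (\<lambda>l. ?\<beta> j (\<sigma> l)) \<longlonglongrightarrow> w k j) \<and>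
      (\<lambda>l. ?\<gamma> (\<sigma> l)) \<longlonglongrightarrow> 0"
    "\<forall>c t. (\<forall>s\<in>?S. (\<Sum>j<n. c j * ?\<beta> j s) - ?\<gamma> s \<le> t) \<longrightarrow> (\<Sum>j<n. c j * v j) \<le> 0"
    using minimizer_recession_decomposition[OF 1 2 \<rho> 3] by (elim exE conjE) (rule that)
  have "(\<Sum>j<n. c j * v j) \<le> 0" if \<psi>: "conjugate g \<psi> < \<infinity>"
    and c: "\<forall>s. g s \<noteq> \<infinity> \<longrightarrow> dual_apply (\<psi> - \<phi>) s = (\<Sum>j<n. c j * ?\<beta> j s)" for c \<psi>
  proof -
    obtain t where t: "conjugate g \<psi> \<le> ereal t" using \<psi> by (cases "conjugate g \<psi>") auto
    have "\<forall>s\<in>?S. (\<Sum>j<n. c j * ?\<beta> j s) - ?\<gamma> s \<le> t - \<alpha>"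
    proof
      fix s assume "s \<in> ?S"
      then have s: "g s \<noteq> \<infinity>" by simp
      then have "dual_apply \<psi> s - real_of_ereal (g s) \<le> t" using t conjugate_le_iff[OF g] by blast
      then show "(\<Sum>j<n. c j * ?\<beta> j s) - ?\<gamma> s \<le> t - \<alpha>"
        using c[rule_format, OF s] by simp
    qed
    then show ?thesis using K(6) by blast
  qed
  then show thesis using K(1-5) by (intro that[of K lam w v]) auto
qed

section \<open>The two inclusions for the formula over finite-dimensional subspaces\<close>

text \<open>For a given \<psi>, the subspace spanned by \<phi> and \<psi> is enough. On it each sum
  lies in a half-space given by \<open>\<psi> - \<phi>\<close>, a weakly closed convex condition
  that survives the closure, the intersection over \<epsilon> and the convex hull.\<close>

lemma dual_subdiff_superset:
  fixes g :: "'a::{real_vector, topological_space} \<Rightarrow> ereal"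
  assumes g: "\<forall>x. g x \<noteq> -\<infinity>" and \<alpha>: "conjugate g \<phi> = ereal \<alpha>"
    and x: "\<And>L. L \<in> fin_dim_subspaces \<phi> \<Longrightarrow> x \<in> convex hull
            (\<Inter>\<epsilon>\<in>{0<..}. weak_topology closure_of
              (set_valued_inv (eps_subdiff \<epsilon> g) \<phi> + normal_cone (L \<inter> edom (conjugate g)) \<phi>))"
  shows "x \<in> dual_subdiff (conjugate g) \<phi>"
  unfolding mem_dual_subdiff_iff[OF \<alpha>]
proof (intro allI impI)
  fix \<psi> t assume t: "conjugate g \<psi> \<le> ereal t"
  define L where "L = span {\<phi>, \<psi>}"
  have "L \<in> fin_dim_subspaces \<phi>"
    unfolding fin_dim_subspaces_def L_def
    by (auto intro: span_base intro!: exI[of _ "{\<phi>, \<psi>}"])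
  have \<psi>L: "\<psi> \<in> L \<inter> edom (conjugate g)"
    using t by (auto simp: L_def edom_def span_base)
  let ?C = "\<lambda>\<epsilon>. weak_topology closure_of
    (set_valued_inv (eps_subdiff \<epsilon> g) \<phi> + normal_cone (L \<inter> edom (conjugate g)) \<phi>)"
  have half: "?C \<epsilon> \<subseteq> {z. dual_apply (\<psi> - \<phi>) z \<le> t - \<alpha> + \<epsilon>}" for \<epsilon>
  proof (rule closure_of_minimal)
    have "closedin weak_topology {z \<in> topspace weak_topology. dual_apply (\<psi> - \<phi>) z \<in> {..t - \<alpha> + \<epsilon>}}"
      by (rule closedin_continuous_map_preimage[OF continuous_map_weak_topology]) simp
    then show "closedin weak_topology {z. dual_apply (\<psi> - \<phi>) z \<le> t - \<alpha> + \<epsilon>}" by simp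
    show "set_valued_inv (eps_subdiff \<epsilon> g) \<phi> + normal_cone (L \<inter> edom (conjugate g)) \<phi>
        \<subseteq> {z. dual_apply (\<psi> - \<phi>) z \<le> t - \<alpha> + \<epsilon>}"
    proof
      fix z assume "z \<in> set_valued_inv (eps_subdiff \<epsilon> g) \<phi> + normal_cone (L \<inter> edom (conjugate g)) \<phi>"
      then obtain s y where sy: "z = s + y" "s \<in> set_valued_inv (eps_subdiff \<epsilon> g) \<phi>"
        "y \<in> normal_cone (L \<inter> edom (conjugate g)) \<phi>"
        by (rule set_plus_elim)
      have s: "g s \<noteq> \<infinity>" "real_of_ereal (g s) - dual_apply \<phi> s + \<alpha> \<le> \<epsilon>"
        using sy(2) eps_subdiff_inverse_conjugate[OF g \<alpha>] by auto
      have "dual_apply \<psi> s - real_of_ereal (g s) \<le> t"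
        using t s(1) conjugate_le_iff[OF g] by blast
      moreover have "dual_apply (\<psi> - \<phi>) y \<le> 0"
        using sy(3) \<psi>L by (auto simp: mem_normal_cone_iff simp del: dual_apply_simps)
      ultimately show "z \<in> {z. dual_apply (\<psi> - \<phi>) z \<le> t - \<alpha> + \<epsilon>}"
        using s(2) by (simp add: sy(1) dual_apply_linear_simps)
    qed
  qed
  have "convex hull (\<Inter>\<epsilon>\<in>{0<..}. ?C \<epsilon>) \<subseteq> {z. dual_apply (\<psi> - \<phi>) z \<le> t - \<alpha>}"
  proof (rule hull_minimal)
    show "(\<Inter>\<epsilon>\<in>{0<..}. ?C \<epsilon>) \<subseteq> {z. dual_apply (\<psi> - \<phi>) z \<le> t - \<alpha>}"
    proof
      fix z assume z: "z \<in> (\<Inter>\<epsilon>\<in>{0<..}. ?C \<epsilon>)"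
      have "dual_apply (\<psi> - \<phi>) z \<le> t - \<alpha>"
      proof (rule field_le_epsilon)
        fix \<epsilon> :: real assume "0 < \<epsilon>"
        then have "z \<in> ?C \<epsilon>" using z by blast
        then show "dual_apply (\<psi> - \<phi>) z \<le> t - \<alpha> + \<epsilon>" using half by blast
      qed
      then show "z \<in> {z. dual_apply (\<psi> - \<phi>) z \<le> t - \<alpha>}" by simp
    qed
    have "{z. dual_apply (\<psi> - \<phi>) z \<le> t - \<alpha>} = dual_apply (\<psi> - \<phi>) -` {..t - \<alpha>}" by auto
    then show "convex {z. dual_apply (\<psi> - \<phi>) z \<le> t - \<alpha>}"
      by (simp add: convex_linear_vimage[OF linear_dual_apply])
  qed
  then have "dual_apply (\<psi> - \<phi>) x \<le> t - \<alpha>" using x[OF \<open>L \<in> _\<close>] by blast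
  then show "\<alpha> + dual_apply (\<psi> - \<phi>) x \<le> t" by simp
qed

text \<open>Normality relative to \<open>L\<close> depends only on finitely many coordinates, so
  minimizing sequences can be corrected inside a finite-dimensional subspace of the primal
  space.\<close>

lemma dual_subdiff_subset:
  fixes g :: "'a::{real_vector, topological_space} \<Rightarrow> ereal"
  assumes g: "\<forall>x. g x \<noteq> -\<infinity>" and \<alpha>: "conjugate g \<phi> = ereal \<alpha>"
    and x: "x \<in> dual_subdiff (conjugate g) \<phi>" and L: "L \<in> fin_dim_subspaces \<phi>"
  shows "x \<in> convex hull (\<Inter>\<epsilon>\<in>{0<..}. weak_topology closure_of
    (set_valued_inv (eps_subdiff \<epsilon> g) \<phi> + normal_cone (L \<inter> edom (conjugate g)) \<phi>))"
proof -
  define D where "D = (\<lambda>\<psi>. \<psi> - \<phi>) ` (L \<inter> edom (conjugate g))"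
  obtain B0 where B0: "subspace L" "finite B0" "L = span B0" "\<phi> \<in> L"
    using L by (auto simp: fin_dim_subspaces_def)
  have \<phi>L: "\<phi> \<in> L \<inter> edom (conjugate g)" using B0(4) \<alpha> by (simp add: edom_def)
  obtain B where B: "B \<subseteq> D" "independent B" "D \<subseteq> span B"
    by (rule maximal_independent_subset)
  have "D \<subseteq> span B0" using B0 by (auto simp: D_def intro: subspace_diff)
  then have "finite B" using independent_span_bound[OF B0(2) B(2)] B(1) by auto
  from biorthogonal_system[OF bilinear_dual_apply(1) this]
  obtain n :: nat and b e where b: "\<forall>i<n. b i \<in> B"
    and be: "\<forall>i<n. \<forall>j<n. dual_apply (b i) (e j) = (if i = j then 1 else 0)"
    and expB: "\<forall>a\<in>B. \<forall>y. dual_apply a y = (\<Sum>i<n. dual_apply a (e i) * dual_apply (b i) y)"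
    by (elim exE conjE) (rule that)
  \<comment> \<open>The identity holds on \<open>B\<close> and is linear in \<open>a\<close>, hence
    it holds on the span of \<open>B\<close>, which contains \<open>D\<close>.\<close>
  have expand: "dual_apply a y = (\<Sum>i<n. dual_apply a (e i) * dual_apply (b i) y)" if "a \<in> D" for a y
  proof -
    have "a \<in> span B" using that B(3) by blast
    moreover have "subspace {a. dual_apply a y = (\<Sum>i<n. dual_apply a (e i) * dual_apply (b i) y)}"
      by (rule subspaceI) (auto simp: distrib_right sum.distrib sum_distrib_left mult.assoc)
    ultimately show ?thesis
      by (rule span_induct) (use expB in blast)
  qed
  have "\<exists>t. conjugate g (\<phi> + b j) \<le> ereal t" if "j < n" for j
  proof -
    have "\<phi> + b j \<in> edom (conjugate g)" using b that B(1) by (force simp: D_def)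
    then show ?thesis unfolding edom_def by (cases "conjugate g (\<phi> + b j)") auto
  qed
  then obtain t where t: "\<And>j. j < n \<Longrightarrow> conjugate g (\<phi> + b j) \<le> ereal (t j)" by metis
  \<comment> \<open>Since \<open>2 * n * \<rho>\<close> is at most 1, the box of radius \<rho> about
    \<phi> plus \<rho> times the sum of the \<open>b j\<close> lies in the simplex with vertices
    \<phi> and \<open>\<phi> + b j\<close>, all in the domain of the conjugate.\<close>
  define \<rho> where "\<rho> = 1 / (2 * (real n + 1))"
  have \<rho>: "0 < \<rho>" by (simp add: \<rho>_def)
  have interior: "\<forall>s. g s \<noteq> \<infinity> \<longrightarrow> (\<Sum>j<n. \<rho> * dual_apply (b j) s) + \<rho> * (\<Sum>j<n. \<bar>dual_apply (b j) s\<bar>) \<le>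
      2 * \<rho> * (\<Sum>j<n. \<bar>t j - \<alpha>\<bar>) + (real_of_ereal (g s) - dual_apply \<phi> s + \<alpha>)"
  proof (intro allI impI)
    fix s assume s: "g s \<noteq> \<infinity>"
    let ?\<gamma> = "real_of_ereal (g s) - dual_apply \<phi> s + \<alpha>"
    have \<gamma>: "0 \<le> ?\<gamma>" using conjugate_le_iff[OF g, of \<phi> \<alpha>] \<alpha> s by (auto simp: algebra_simps)
    have "dual_apply (b j) s + \<bar>dual_apply (b j) s\<bar> \<le> 2 * (?\<gamma> + \<bar>t j - \<alpha>\<bar>)" if "j < n" for j
    proof -
      have "dual_apply (\<phi> + b j) s - real_of_ereal (g s) \<le> t j"
        using t[OF that] s conjugate_le_iff[OF g] by blast
      then have "dual_apply (b j) s \<le> ?\<gamma> + \<bar>t j - \<alpha>\<bar>" unfolding dual_apply_simps by linarith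
      moreover have "0 \<le> ?\<gamma> + \<bar>t j - \<alpha>\<bar>" using \<gamma> by simp
      ultimately show ?thesis by (cases "0 \<le> dual_apply (b j) s") (simp_all add: abs_if)
    qed
    then have "(\<Sum>j<n. dual_apply (b j) s + \<bar>dual_apply (b j) s\<bar>) \<le> (\<Sum>j<n. 2 * (?\<gamma> + \<bar>t j - \<alpha>\<bar>))"
      by (intro sum_mono) auto
    also have "\<dots> = 2 * real n * ?\<gamma> + 2 * (\<Sum>j<n. \<bar>t j - \<alpha>\<bar>)"
      by (simp add: distrib_left sum.distrib sum_distrib_left)
    finally have "\<rho> * (\<Sum>j<n. dual_apply (b j) s + \<bar>dual_apply (b j) s\<bar>) \<le>
        \<rho> * (2 * real n * ?\<gamma> + 2 * (\<Sum>j<n. \<bar>t j - \<alpha>\<bar>))"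
      using \<rho> by simp
    moreover have "\<rho> * (2 * real n) * ?\<gamma> \<le> 1 * ?\<gamma>"
      using \<gamma> by (intro mult_right_mono) (simp_all add: \<rho>_def divide_simps)
    ultimately show "(\<Sum>j<n. \<rho> * dual_apply (b j) s) + \<rho> * (\<Sum>j<n. \<bar>dual_apply (b j) s\<bar>) \<le>
        2 * \<rho> * (\<Sum>j<n. \<bar>t j - \<alpha>\<bar>) + ?\<gamma>"
      by (simp add: sum.distrib distrib_left sum_distrib_left mult.assoc mult.left_commute)
  qed
  obtain K :: "nat set" and lam w v where K: "finite K" "\<forall>k\<in>K. 0 \<le> lam k" "sum lam K = 1"
    "\<forall>j<n. dual_apply (b j) x = (\<Sum>k\<in>K. lam k * w k j) + v j"
    "\<forall>k\<in>K. \<exists>\<sigma>. (\<forall>l. g (\<sigma> l) \<noteq> \<infinity>) \<and> (\<forall>j<n. (\<lambda>l. dual_apply (b j) (\<sigma> l)) \<longlonglongrightarrow> w k j) \<and>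
      (\<lambda>l::nat. real_of_ereal (g (\<sigma> l)) - dual_apply \<phi> (\<sigma> l) + \<alpha>) \<longlonglongrightarrow> 0"
    "\<And>c \<psi>. conjugate g \<psi> < \<infinity> \<Longrightarrow>
      \<forall>s. g s \<noteq> \<infinity> \<longrightarrow> dual_apply (\<psi> - \<phi>) s = (\<Sum>j<n. c j * dual_apply (b j) s) \<Longrightarrow>
      (\<Sum>j<n. c j * v j) \<le> (0::real)"
    by (rule subgradient_decomposition[OF g \<alpha> x \<rho> interior]) (rule that; assumption)
  have cone: "z \<in> normal_cone (L \<inter> edom (conjugate g)) \<phi>" if z: "\<forall>j<n. dual_apply (b j) z = v j" for z
    unfolding mem_normal_cone_iff
  proof (intro conjI \<phi>L ballI)
    fix \<psi> assume \<psi>: "\<psi> \<in> L \<inter> edom (conjugate g)"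
    then have D: "\<psi> - \<phi> \<in> D" by (simp add: D_def)
    have "dual_apply (\<psi> - \<phi>) z = (\<Sum>i<n. dual_apply (\<psi> - \<phi>) (e i) * v i)"
      using z by (subst expand[OF D]) (intro sum.cong, auto)
    also have "\<dots> \<le> 0"
    proof (rule K(6))
      show "conjugate g \<psi> < \<infinity>" using \<psi> by (simp add: edom_def)
      show "\<forall>s. g s \<noteq> \<infinity> \<longrightarrow>
          dual_apply (\<psi> - \<phi>) s = (\<Sum>i<n. dual_apply (\<psi> - \<phi>) (e i) * dual_apply (b i) s)"
        using expand[OF D] by blast
    qed
    finally show "dual_apply (\<psi> - \<phi>) z \<le> 0" .
  qed
  \<comment> \<open>\<open>y k\<close> realizes the limit coordinates \<open>w k\<close> by the dual
    points \<open>e i\<close>; the remainder \<open>x'\<close> then has coordinates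
    \<open>v\<close>.\<close>
  define y where "y k = (\<Sum>i<n. w k i *\<^sub>R e i)" for k
  define x' where "x' = x - (\<Sum>k\<in>K. lam k *\<^sub>R y k)"
  have be_sum: "dual_apply (b j) (\<Sum>i<n. c i *\<^sub>R e i) = c j" if "j < n" for c j
  proof -
    have "dual_apply (b j) (\<Sum>i<n. c i *\<^sub>R e i) = (\<Sum>i<n. c i * (if j = i then 1 else 0))"
      unfolding dual_apply_linear_simps using be[rule_format, OF that] by (intro sum.cong) simp_all
    then show ?thesis using that by (simp add: if_distrib cong: if_cong)
  qed
  have x'v: "dual_apply (b j) x' = v j" if "j < n" for j
    using K(4) be_sum[OF that] that by (simp add: x'_def dual_apply_linear_simps(2-) y_def del: scaleR_sum_right)
  let ?C = "\<Inter>\<epsilon>\<in>{0<..}. weak_topology closure_of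
    (set_valued_inv (eps_subdiff \<epsilon> g) \<phi> + normal_cone (L \<inter> edom (conjugate g)) \<phi>)"
  have "y k + x' \<in> ?C" if k: "k \<in> K" for k
  proof
    fix \<epsilon> :: real assume \<epsilon>: "\<epsilon> \<in> {0<..}"
    obtain \<sigma> where \<sigma>: "\<forall>l. g (\<sigma> l) \<noteq> \<infinity>" "\<forall>j<n. (\<lambda>l. dual_apply (b j) (\<sigma> l)) \<longlonglongrightarrow> w k j"
      "(\<lambda>l::nat. real_of_ereal (g (\<sigma> l)) - dual_apply \<phi> (\<sigma> l) + \<alpha>) \<longlonglongrightarrow> 0"
      using K(5) k by blast
    \<comment> \<open>The sequence \<open>\<sigma>\<close> itself need not converge weakly. Adding
      to the limit the vanishing coordinate errors of \<open>\<sigma> l\<close> gives a convergent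
      \<open>z\<close> such that \<open>z l - \<sigma> l\<close> has coordinates \<open>v\<close>
      and is therefore normal.\<close>
    define z where "z l = y k + x' + (\<Sum>i<n. (dual_apply (b i) (\<sigma> l) - w k i) *\<^sub>R e i)" for l
    have "limitin weak_topology z (y k + x') sequentially"
    proof (rule limitin_weak_topology)
      fix \<psi>
      have "(\<lambda>l. dual_apply \<psi> (y k + x') +
          (\<Sum>i<n. (dual_apply (b i) (\<sigma> l) - w k i) * dual_apply \<psi> (e i))) \<longlonglongrightarrow>
        dual_apply \<psi> (y k + x') + (\<Sum>i<n. (w k i - w k i) * dual_apply \<psi> (e i))"
        using \<sigma>(2) by (intro tendsto_intros) auto
      then show "(\<lambda>l. dual_apply \<psi> (z l)) \<longlonglongrightarrow> dual_apply \<psi> (y k + x')"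
        by (simp add: z_def dual_apply_linear_simps)
    qed
    moreover have "\<forall>\<^sub>F l in sequentially. z l \<in>
        set_valued_inv (eps_subdiff \<epsilon> g) \<phi> + normal_cone (L \<inter> edom (conjugate g)) \<phi>"
    proof -
      have "\<forall>\<^sub>F l in sequentially. real_of_ereal (g (\<sigma> l)) - dual_apply \<phi> (\<sigma> l) + \<alpha> < \<epsilon>"
        using \<epsilon> by (intro order_tendstoD(2)[OF \<sigma>(3)]) auto
      then show ?thesis
      proof (rule eventually_mono)
        fix l assume l: "real_of_ereal (g (\<sigma> l)) - dual_apply \<phi> (\<sigma> l) + \<alpha> < \<epsilon>"
        have "\<sigma> l \<in> set_valued_inv (eps_subdiff \<epsilon> g) \<phi>"
          using l \<sigma>(1) eps_subdiff_inverse_conjugate[OF g \<alpha>] by simp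
        moreover have "z l - \<sigma> l \<in> normal_cone (L \<inter> edom (conjugate g)) \<phi>"
        proof (rule cone, intro allI impI)
          fix j assume j: "j < n"
          have "dual_apply (b j) (y k) = w k j" unfolding y_def by (rule be_sum[OF j])
          then show "dual_apply (b j) (z l - \<sigma> l) = v j"
            using x'v[OF j] be_sum[OF j]
            by (simp only: z_def dual_apply_linear_simps(1,2))
        qed
        ultimately show "z l \<in> set_valued_inv (eps_subdiff \<epsilon> g) \<phi> +
            normal_cone (L \<inter> edom (conjugate g)) \<phi>"
          using set_plus_intro by fastforce
      qed
    qed
    ultimately show "y k + x' \<in> weak_topology closure_of
        (set_valued_inv (eps_subdiff \<epsilon> g) \<phi> + normal_cone (L \<inter> edom (conjugate g)) \<phi>)"
      by (rule limitin_imp_in_closure_of)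
  qed
  then have "(\<Sum>k\<in>K. lam k *\<^sub>R (y k + x')) \<in> convex hull ?C"
    using K(1-3) by (intro convex_sum) (auto intro: hull_inc)
  \<comment> \<open>The weights sum to 1, so attaching \<open>x'\<close> to every \<open>y k\<close>
    adds it exactly once.\<close>
  moreover have "(\<Sum>k\<in>K. lam k *\<^sub>R (y k + x')) = x"
    using K(3) by (simp add: scaleR_add_right sum.distrib scaleR_left.sum[symmetric] x'_def)
  ultimately show ?thesis by simp
qed

section \<open>Continuity of the conjugate at a point\<close>

lemma lsc_hull_le: "lsc_hull T h x \<le> h x" if "topspace T = UNIV"
proof (rule ereal_le_real)
  fix t assume "h x \<le> ereal t"
  then have "(x, t) \<in> epi h" by (simp add: epi_def)
  then have "(x, t) \<in> prod_topology T euclideanreal closure_of epi h"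
    using closure_of_subset[of "epi h" "prod_topology T euclideanreal"] that by auto
  then show "lsc_hull T h x \<le> ereal t" unfolding lsc_hull_def by (intro Inf_lower) auto
qed

text \<open>The epigraph of a continuous affine function is closed, so an affine minorant of
  \<open>g\<close> is also one of its hull.\<close>

lemma lsc_hull_ge_affine:
  assumes "continuous_map T euclideanreal (dual_apply \<psi>)"
    and "\<And>s. ereal (dual_apply \<psi> s - c) \<le> g s"
  shows "ereal (dual_apply \<psi> y - c) \<le> lsc_hull T g y"
proof -
  let ?P = "prod_topology T euclideanreal"
  have "continuous_map ?P euclideanreal (\<lambda>p. dual_apply \<psi> (fst p))"
    using continuous_map_compose[OF continuous_map_fst assms(1)] by (simp add: o_def)
  then have "continuous_map ?P euclideanreal (\<lambda>p. dual_apply \<psi> (fst p) - snd p)"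
    by (rule continuous_map_diff) (rule continuous_map_snd)
  then have cl: "closedin ?P {p \<in> topspace ?P. dual_apply \<psi> (fst p) - snd p \<in> {..c}}"
    by (rule closedin_continuous_map_preimage) simp
  have "?P closure_of epi g \<subseteq> {p. dual_apply \<psi> (fst p) - snd p \<le> c}"
  proof -
    have "?P closure_of (topspace ?P \<inter> epi g) \<subseteq> {p \<in> topspace ?P. dual_apply \<psi> (fst p) - snd p \<in> {..c}}"
    proof (rule closure_of_minimal[OF _ cl], rule subsetI)
      fix p assume p: "p \<in> topspace ?P \<inter> epi g"
      then have "g (fst p) \<le> ereal (snd p)" by (auto simp: epi_def)
      then have "ereal (dual_apply \<psi> (fst p) - c) \<le> ereal (snd p)" using assms(2) order_trans by blast
      then show "p \<in> {p \<in> topspace ?P. dual_apply \<psi> (fst p) - snd p \<in> {..c}}" using p by simp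
    qed
    then show ?thesis by (subst closure_of_restrict) auto
  qed
  then show ?thesis unfolding lsc_hull_def by (intro Inf_greatest) fastforce
qed

lemma lsc_hull_le_limit:
  assumes "limitin T \<sigma> y sequentially" "r \<longlonglongrightarrow> t" "\<And>l. g (\<sigma> l) \<le> ereal (r l)"
  shows "lsc_hull T g y \<le> ereal t"
proof -
  have "limitin (prod_topology T euclideanreal) (\<lambda>l. (\<sigma> l, r l)) (y, t) sequentially"
    using assms(1,2) by (simp add: limitin_pairwise o_def)
  then have "(y, t) \<in> prod_topology T euclideanreal closure_of epi g"
    by (rule limitin_imp_in_closure_of) (simp add: epi_def assms(3))
  then show ?thesis unfolding lsc_hull_def by (intro Inf_lower) auto
qed

lemma open_top_dual_contains_finite_nbhd:
  fixes U :: "'a::{real_vector, topological_space} top_dual set"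
  assumes "open U" "\<phi> \<in> U"
  shows "\<exists>A \<rho>. finite A \<and> 0 < \<rho> \<and> (\<forall>\<psi>. (\<forall>a\<in>A. \<bar>dual_apply \<psi> a - dual_apply \<phi> a\<bar> < \<rho>) \<longrightarrow> \<psi> \<in> U)"
proof -
  have "generate_topology {(\<lambda>\<phi>. dual_apply \<phi> x) -` V | x V. open V} U"
    using assms(1) by (simp add: open_top_dual_def)
  then show ?thesis using assms(2)
  proof (induction rule: generate_topology.induct)
    case UNIV
    show ?case by (intro exI[of _ "{}"] exI[of _ 1]) auto
  next
    case (Int U V)
    obtain A \<rho> where A: "finite A" "0 < \<rho>"
      "\<forall>\<psi>. (\<forall>a\<in>A. \<bar>dual_apply \<psi> a - dual_apply \<phi> a\<bar> < \<rho>) \<longrightarrow> \<psi> \<in> U"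
      using Int by blast
    obtain B \<mu> where B: "finite B" "0 < \<mu>"
      "\<forall>\<psi>. (\<forall>a\<in>B. \<bar>dual_apply \<psi> a - dual_apply \<phi> a\<bar> < \<mu>) \<longrightarrow> \<psi> \<in> V"
      using Int by blast
    show ?case using A B by (intro exI[of _ "A \<union> B"] exI[of _ "min \<rho> \<mu>"]) auto
  next
    case (UN K)
    then obtain k where "k \<in> K" "\<phi> \<in> k" by blast
    with UN.IH[OF this] show ?case by blast
  next
    case (Basis s)
    then obtain x V where s: "s = (\<lambda>\<phi>. dual_apply \<phi> x) -` V" "open V" by blast
    then obtain e where "e > 0" "ball (dual_apply \<phi> x) e \<subseteq> V"
      using Basis(2) by (auto simp: open_contains_ball)
    then show ?case
      by (intro exI[of _ "{x}"] exI[of _ e]) (auto simp: s(1) dist_real_def abs_minus_commute)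
  qed
qed

lemma isCont_ereal_bounded_nbhd:
  fixes f :: "'a::{real_vector, topological_space} top_dual \<Rightarrow> ereal"
  assumes "\<bar>f \<phi>\<bar> \<noteq> \<infinity>" "isCont f \<phi>"
  obtains A \<rho> M where "finite A" "0 < \<rho>"
    "\<And>\<psi>. \<forall>a\<in>A. \<bar>dual_apply \<psi> a - dual_apply \<phi> a\<bar> < \<rho> \<Longrightarrow> f \<psi> \<le> ereal M"
proof -
  obtain r where r: "f \<phi> = ereal r" using assms(1) by auto
  have "\<forall>\<^sub>F \<psi> in at \<phi>. f \<psi> < ereal (r + 1)"
    using assms(2) r unfolding isCont_def by (intro order_tendstoD(2)) auto
  then obtain U where U: "open U" "\<phi> \<in> U" "\<And>\<psi>. \<psi> \<in> U \<Longrightarrow> \<psi> \<noteq> \<phi> \<Longrightarrow> f \<psi> < ereal (r + 1)"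
    unfolding eventually_at_topological by blast
  \<comment> \<open>The filter \<open>at \<phi>\<close> omits \<phi> itself, where the bound follows
    from the value \<open>r\<close>.\<close>
  have "f \<psi> \<le> ereal (r + 1)" if "\<psi> \<in> U" for \<psi>
    using U(3)[OF that] r by (cases "\<psi> = \<phi>") auto
  with open_top_dual_contains_finite_nbhd[OF U(1,2)] show thesis using that by blast
qed

lemma unbounded_line_imp_zero:
  fixes a b c :: real
  assumes "\<And>t. c + t * a \<le> b"
  shows "a = 0"
proof (rule ccontr)
  assume "a \<noteq> 0"
  with assms[of "(b - c + 1) / a"] show False by simp
qed

text \<open>
  Boundedness of the conjugate near \<open>\<phi>\<^sub>0\<close> forces the domain of \<open>g\<close>, and all subgradients, into the
  span of the finite set \<open>A\<close> as far as the pairing can see.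
\<close>

lemma dual_subdiff_subset_of_bounded_nbhd:
  fixes g :: "'a::{real_vector, topological_space} \<Rightarrow> ereal"
  assumes g: "\<forall>x. g x \<noteq> -\<infinity>" and \<alpha>: "conjugate g \<phi> = ereal \<alpha>"
    and T: "topspace T = UNIV"
    and contT: "\<And>\<psi>. continuous_map T euclideanreal (dual_apply \<psi>)"
    and limT: "\<And>\<sigma> x. \<forall>\<psi>. (\<lambda>l. dual_apply \<psi> (\<sigma> l)) \<longlonglongrightarrow> dual_apply \<psi> x \<Longrightarrow> limitin T \<sigma> x sequentially"
    and A: "finite A" and \<rho>: "0 < \<rho>"
    and bound: "\<And>\<psi>. \<forall>a\<in>A. \<bar>dual_apply \<psi> a - dual_apply \<phi>\<^sub>0 a\<bar> < \<rho> \<Longrightarrow> conjugate g \<psi> \<le> ereal M"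
    and x: "x \<in> dual_subdiff (conjugate g) \<phi>"
  shows "x \<in> convex hull (set_valued_inv (subdiff (lsc_hull T g)) \<phi>) + normal_cone (edom (conjugate g)) \<phi>"
proof -
  obtain n :: nat and e d where eA: "\<forall>i<n. e i \<in> A"
    and ed: "\<forall>i<n. \<forall>j<n. dual_apply (d j) (e i) = (if i = j then 1 else 0)"
    and expA: "\<forall>a\<in>A. \<forall>\<psi>. dual_apply \<psi> a = (\<Sum>i<n. dual_apply (d i) a * dual_apply \<psi> (e i))"
    using biorthogonal_system[OF bilinear_dual_apply(2) A] by (elim exE conjE) (rule that)
  \<comment> \<open>The part of \<open>z\<close> that vanishes on \<open>A\<close>. Adding any
    multiple of it to \<open>\<phi>\<^sub>0\<close> stays in the neighbourhood where the conjugate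
    is bounded.\<close>
  define R where "R z = z - (\<Sum>i<n. dual_apply z (e i) *\<^sub>R d i)" for z
  have R: "\<forall>a\<in>A. \<bar>dual_apply (\<phi>\<^sub>0 + t *\<^sub>R R z) a - dual_apply \<phi>\<^sub>0 a\<bar> < \<rho>" for t z
  proof
    fix a assume "a \<in> A"
    then have "dual_apply z a = (\<Sum>i<n. dual_apply (d i) a * dual_apply z (e i))" using expA by blast
    then have "dual_apply (R z) a = 0" by (simp add: R_def dual_apply_sum mult.commute)
    then show "\<bar>dual_apply (\<phi>\<^sub>0 + t *\<^sub>R R z) a - dual_apply \<phi>\<^sub>0 a\<bar> < \<rho>" using \<rho> by simp
  qed
  have expand: "dual_apply z y = (\<Sum>i<n. dual_apply z (e i) * dual_apply (d i) y)"
    if "dual_apply (R z) y = 0" for z y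
    using that by (simp add: R_def dual_apply_sum)
  have perp: "dual_apply (R z) s = 0" if s: "g s \<noteq> \<infinity>" for z s
  proof (rule unbounded_line_imp_zero)
    fix t
    have "dual_apply (\<phi>\<^sub>0 + t *\<^sub>R R z) s - real_of_ereal (g s) \<le> M"
      using bound[OF R] s conjugate_le_iff[OF g] by blast
    then show "dual_apply \<phi>\<^sub>0 s + t * dual_apply (R z) s \<le> M + real_of_ereal (g s)" by simp
  qed
  have perpx: "dual_apply (R z) x = 0" for z
  proof (rule unbounded_line_imp_zero)
    fix t
    have "\<alpha> + dual_apply (\<phi>\<^sub>0 + t *\<^sub>R R z - \<phi>) x \<le> M"
      using bound[OF R] x mem_dual_subdiff_iff[OF \<alpha>] by blast
    then show "dual_apply (\<phi>\<^sub>0 - \<phi>) x + t * dual_apply (R z) x \<le> M - \<alpha>" by simp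
  qed
  \<comment> \<open>Coefficients of size at most \<open>\<rho> / C\<close> on the \<open>d j\<close>
    change the value at each \<open>a\<close> in \<open>A\<close> by less than \<rho>; the summand 1
    gives strictness and avoids division by 0.\<close>
  define C where "C = 1 + (\<Sum>a\<in>A. \<Sum>i<n. \<bar>dual_apply (d i) a\<bar>)"
  have C1: "1 \<le> C" unfolding C_def by (simp add: sum_nonneg)
  define r where "r = \<rho> / C"
  have r: "0 < r" using \<rho> C1 by (simp add: r_def)
  have interior: "\<forall>s. g s \<noteq> \<infinity> \<longrightarrow>
      (\<Sum>j<n. dual_apply (\<phi>\<^sub>0 - \<phi>) (e j) * dual_apply (d j) s) + r * (\<Sum>j<n. \<bar>dual_apply (d j) s\<bar>) \<le>
      (M - \<alpha>) + (real_of_ereal (g s) - dual_apply \<phi> s + \<alpha>)"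
  proof (intro allI impI)
    fix s assume s: "g s \<noteq> \<infinity>"
    \<comment> \<open>The vertex of the coordinate box selected by the signs at \<open>s\<close>;
      evaluating it there produces the sum of absolute values.\<close>
    define \<psi> where "\<psi> = \<phi>\<^sub>0 + (\<Sum>j<n. (r * sgn (dual_apply (d j) s)) *\<^sub>R d j)"
    have "\<forall>a\<in>A. \<bar>dual_apply \<psi> a - dual_apply \<phi>\<^sub>0 a\<bar> < \<rho>"
    proof
      fix a assume a: "a \<in> A"
      have "\<bar>dual_apply \<psi> a - dual_apply \<phi>\<^sub>0 a\<bar> = \<bar>\<Sum>j<n. r * sgn (dual_apply (d j) s) * dual_apply (d j) a\<bar>"
        by (simp add: \<psi>_def dual_apply_sum)
      also have "\<dots> \<le> (\<Sum>j<n. \<bar>r * sgn (dual_apply (d j) s) * dual_apply (d j) a\<bar>)"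
        by (rule sum_abs)
      also have "\<dots> \<le> (\<Sum>j<n. r * \<bar>dual_apply (d j) a\<bar>)"
        using r by (intro sum_mono) (simp add: abs_mult abs_sgn_eq)
      also have "\<dots> = r * (\<Sum>j<n. \<bar>dual_apply (d j) a\<bar>)" by (simp add: sum_distrib_left)
      also have "\<dots> < r * C"
      proof -
        have "(\<Sum>j<n. \<bar>dual_apply (d j) a\<bar>) \<le> (\<Sum>a\<in>A. \<Sum>i<n. \<bar>dual_apply (d i) a\<bar>)"
          using a A by (intro member_le_sum) (auto intro: sum_nonneg)
        then show ?thesis using r by (simp add: C_def)
      qed
      also have "\<dots> = \<rho>" using C1 by (simp add: r_def)
      finally show "\<bar>dual_apply \<psi> a - dual_apply \<phi>\<^sub>0 a\<bar> < \<rho>" .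
    qed
    from bound[OF this] have "dual_apply \<psi> s - real_of_ereal (g s) \<le> M"
      using s conjugate_le_iff[OF g] by blast
    moreover have "dual_apply \<psi> s = dual_apply \<phi>\<^sub>0 s + r * (\<Sum>j<n. \<bar>dual_apply (d j) s\<bar>)"
      by (simp add: \<psi>_def dual_apply_sum sum_distrib_left abs_sgn mult.assoc mult.commute[of "sgn _"])
    moreover have "dual_apply (\<phi>\<^sub>0 - \<phi>) s = (\<Sum>j<n. dual_apply (\<phi>\<^sub>0 - \<phi>) (e j) * dual_apply (d j) s)"
      using expand[OF perp[OF s]] .
    ultimately show "(\<Sum>j<n. dual_apply (\<phi>\<^sub>0 - \<phi>) (e j) * dual_apply (d j) s) +
        r * (\<Sum>j<n. \<bar>dual_apply (d j) s\<bar>) \<le> (M - \<alpha>) + (real_of_ereal (g s) - dual_apply \<phi> s + \<alpha>)"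
      unfolding dual_apply_simps(4) by linarith
  qed
  obtain K :: "nat set" and lam w v where K: "finite K" "\<forall>k\<in>K. 0 \<le> lam k" "sum lam K = 1"
    "\<forall>j<n. dual_apply (d j) x = (\<Sum>k\<in>K. lam k * w k j) + v j"
    "\<forall>k\<in>K. \<exists>\<sigma>. (\<forall>l. g (\<sigma> l) \<noteq> \<infinity>) \<and> (\<forall>j<n. (\<lambda>l. dual_apply (d j) (\<sigma> l)) \<longlonglongrightarrow> w k j) \<and>
      (\<lambda>l::nat. real_of_ereal (g (\<sigma> l)) - dual_apply \<phi> (\<sigma> l) + \<alpha>) \<longlonglongrightarrow> 0"
    "\<And>c \<psi>. conjugate g \<psi> < \<infinity> \<Longrightarrow>
      \<forall>s. g s \<noteq> \<infinity> \<longrightarrow> dual_apply (\<psi> - \<phi>) s = (\<Sum>j<n. c j * dual_apply (d j) s) \<Longrightarrow>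
      (\<Sum>j<n. c j * v j) \<le> (0::real)"
    by (rule subgradient_decomposition[OF g \<alpha> x r interior]) (rule that; assumption)
  define y where "y k = (\<Sum>i<n. w k i *\<^sub>R e i)" for k
  define x' where "x' = x - (\<Sum>k\<in>K. lam k *\<^sub>R y k)"
  have dy: "dual_apply (d j) (y k) = w k j" if "j < n" for j k
  proof -
    have "dual_apply (d j) (y k) = (\<Sum>i<n. w k i * (if i = j then 1 else 0))"
      unfolding y_def dual_apply_linear_simps using ed that by (intro sum.cong) simp_all
    then show ?thesis using that by (simp add: if_distrib cong: if_cong)
  qed
  have x'v: "dual_apply (d j) x' = v j" if "j < n" for j
    using K(4) dy[OF that] that by (simp add: x'_def dual_apply_linear_simps(2-))
  have yK: "y k \<in> set_valued_inv (subdiff (lsc_hull T g)) \<phi>" if k: "k \<in> K" for k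
  proof -
    obtain \<sigma> where \<sigma>: "\<forall>l. g (\<sigma> l) \<noteq> \<infinity>" "\<forall>j<n. (\<lambda>l. dual_apply (d j) (\<sigma> l)) \<longlonglongrightarrow> w k j"
      "(\<lambda>l::nat. real_of_ereal (g (\<sigma> l)) - dual_apply \<phi> (\<sigma> l) + \<alpha>) \<longlonglongrightarrow> 0"
      using K(5) k by blast
    \<comment> \<open>On the domain of \<open>g\<close> every functional equals its expansion in the
      \<open>d i\<close>, so here coordinatewise convergence is convergence against all
      functionals.\<close>
    have lim: "(\<lambda>l. dual_apply \<psi> (\<sigma> l)) \<longlonglongrightarrow> dual_apply \<psi> (y k)" for \<psi>
    proof -
      have "(\<lambda>l. \<Sum>i<n. dual_apply \<psi> (e i) * dual_apply (d i) (\<sigma> l)) \<longlonglongrightarrow>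
          (\<Sum>i<n. dual_apply \<psi> (e i) * w k i)"
        using \<sigma>(2) by (intro tendsto_intros) auto
      moreover have "(\<Sum>i<n. dual_apply \<psi> (e i) * dual_apply (d i) (\<sigma> l)) = dual_apply \<psi> (\<sigma> l)" for l
        using expand[OF perp[OF \<sigma>(1)[rule_format]]] by metis
      moreover have "(\<Sum>i<n. dual_apply \<psi> (e i) * w k i) = dual_apply \<psi> (y k)"
        by (simp add: y_def dual_apply_linear_simps mult.commute)
      ultimately show ?thesis by simp
    qed
    have "(\<lambda>l. (real_of_ereal (g (\<sigma> l)) - dual_apply \<phi> (\<sigma> l) + \<alpha>) + dual_apply \<phi> (\<sigma> l) - \<alpha>)
        \<longlonglongrightarrow> 0 + dual_apply \<phi> (y k) - \<alpha>"
      using \<sigma>(3) lim by (intro tendsto_intros)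
    then have "(\<lambda>l. real_of_ereal (g (\<sigma> l))) \<longlonglongrightarrow> dual_apply \<phi> (y k) - \<alpha>" by simp
    moreover have "g (\<sigma> l) \<le> ereal (real_of_ereal (g (\<sigma> l)))" for l
      using g[rule_format, of "\<sigma> l"] \<sigma>(1)[rule_format, of l] by (cases "g (\<sigma> l)") auto
    ultimately have le: "lsc_hull T g (y k) \<le> ereal (dual_apply \<phi> (y k) - \<alpha>)"
      using limT lim by (intro lsc_hull_le_limit) auto
    have "ereal (dual_apply \<phi> s - \<alpha>) \<le> g s" for s
      using conjugate_ge[of \<phi> s g] \<alpha> g[rule_format, of s] by (cases "g s") auto
    then have ge: "ereal (dual_apply \<phi> z - \<alpha>) \<le> lsc_hull T g z" for z
      by (rule lsc_hull_ge_affine[OF contT])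
    \<comment> \<open>The hull meets its affine minorant \<open>\<phi> - \<alpha>\<close> at
      \<open>y k\<close>, which makes \<phi> an exact subgradient there.\<close>
    have eq: "lsc_hull T g (y k) = ereal (dual_apply \<phi> (y k) - \<alpha>)"
      using le ge by (rule antisym)
    show ?thesis
      using ge by (simp add: set_valued_inv_def eps_subdiff_def eq dual_apply_linear_simps)
  qed
  have "x' \<in> normal_cone (edom (conjugate g)) \<phi>"
    unfolding mem_normal_cone_iff
  proof (intro conjI ballI)
    show "\<phi> \<in> edom (conjugate g)" using \<alpha> by (simp add: edom_def)
    fix \<psi> assume \<psi>: "\<psi> \<in> edom (conjugate g)"
    have "dual_apply (R z) (e i) = 0" if "i < n" for z i
    proof -
      have "dual_apply z (e i) = (\<Sum>j<n. dual_apply (d j) (e i) * dual_apply z (e j))"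
        using expA eA that by blast
      then show ?thesis by (simp add: R_def dual_apply_sum mult.commute)
    qed
    \<comment> \<open>Residuals vanish at \<open>x\<close> and at each \<open>e i\<close>, hence at
      \<open>x'\<close>; so \<psi> can be tested on \<open>x'\<close> through the coordinates
      \<open>v\<close>.\<close>
    then have "dual_apply (R z) x' = 0" for z
      by (simp only: x'_def y_def dual_apply_linear_simps perpx) simp
    then have "dual_apply (\<psi> - \<phi>) x' = (\<Sum>i<n. dual_apply (\<psi> - \<phi>) (e i) * dual_apply (d i) x')"
      by (rule expand)
    also have "\<dots> = (\<Sum>i<n. dual_apply (\<psi> - \<phi>) (e i) * v i)"
      using x'v by (intro sum.cong) auto
    also have "\<dots> \<le> 0"
    proof (rule K(6))
      show "conjugate g \<psi> < \<infinity>" using \<psi> by (simp add: edom_def)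
      show "\<forall>s. g s \<noteq> \<infinity> \<longrightarrow>
          dual_apply (\<psi> - \<phi>) s = (\<Sum>i<n. dual_apply (\<psi> - \<phi>) (e i) * dual_apply (d i) s)"
        using expand perp by blast
    qed
    finally show "dual_apply (\<psi> - \<phi>) x' \<le> 0" .
  qed
  moreover have "(\<Sum>k\<in>K. lam k *\<^sub>R y k) \<in> convex hull (set_valued_inv (subdiff (lsc_hull T g)) \<phi>)"
    using K(1-3) yK by (intro convex_sum) (auto intro: hull_inc)
  ultimately show ?thesis
    using set_plus_intro[of "\<Sum>k\<in>K. lam k *\<^sub>R y k" _ x'] by (simp add: x'_def)
qed

section \<open>The reverse inclusion and the formulas under continuity\<close>

text \<open>Continuous affine minorants are the same for \<open>g\<close> and its hull: the minorant
  of slope \<phi> touching the hull at \<open>y\<close> bounds \<alpha> from above, and the other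
  slopes bound the hull at \<open>y\<close> from below.\<close>

lemma subdiff_lsc_hull_inverse_subset:
  assumes g: "\<forall>x. g x \<noteq> -\<infinity>" and T: "topspace T = UNIV"
    and contT: "\<And>\<psi>. continuous_map T euclideanreal (dual_apply \<psi>)"
    and \<alpha>: "conjugate g \<phi> = ereal \<alpha>"
  shows "set_valued_inv (subdiff (lsc_hull T g)) \<phi> \<subseteq> dual_subdiff (conjugate g) \<phi>"
proof
  fix y assume "y \<in> set_valued_inv (subdiff (lsc_hull T g)) \<phi>"
  then have fin: "\<bar>lsc_hull T g y\<bar> \<noteq> \<infinity>"
    and sub: "\<And>z. lsc_hull T g z \<ge> lsc_hull T g y + ereal (dual_apply \<phi> (z - y)) - ereal 0"
    by (auto simp: set_valued_inv_def eps_subdiff_def split: if_splits)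
  obtain r where r: "lsc_hull T g y = ereal r" using fin by auto
  have "conjugate g \<phi> \<le> ereal (dual_apply \<phi> y - r)"
    unfolding conjugate_le_iff[OF g]
  proof (intro allI impI)
    fix s assume s: "g s \<noteq> \<infinity>"
    have "ereal r + ereal (dual_apply \<phi> (s - y)) - ereal 0 \<le> g s"
      using order_trans[OF sub lsc_hull_le[OF T], of s] unfolding r .
    then show "dual_apply \<phi> s - real_of_ereal (g s) \<le> dual_apply \<phi> y - r"
      using s g[rule_format, of s] by (cases "g s") (auto simp: dual_apply_linear_simps)
  qed
  then have \<alpha>r: "\<alpha> \<le> dual_apply \<phi> y - r" using \<alpha> by simp
  show "y \<in> dual_subdiff (conjugate g) \<phi>"
    unfolding mem_dual_subdiff_iff[OF \<alpha>]
  proof (intro allI impI)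
    fix \<psi> t assume t: "conjugate g \<psi> \<le> ereal t"
    have "ereal (dual_apply \<psi> s - t) \<le> g s" for s
      using order_trans[OF conjugate_ge[of \<psi> s g] t] g[rule_format, of s] by (cases "g s") auto
    then have "ereal (dual_apply \<psi> y - t) \<le> lsc_hull T g y"
      by (rule lsc_hull_ge_affine[OF contT])
    then show "\<alpha> + dual_apply (\<psi> - \<phi>) y \<le> t" using \<alpha>r r by simp
  qed
qed

lemma convex_dual_subdiff:
  assumes \<alpha>: "conjugate g \<phi> = ereal \<alpha>"
  shows "convex (dual_subdiff (conjugate g) \<phi>)"
  unfolding convex_def mem_dual_subdiff_iff[OF \<alpha>]
proof (intro ballI allI impI)
  fix x y and u v t :: real and \<psi>
  assume xy: "x \<in> dual_subdiff (conjugate g) \<phi>" "y \<in> dual_subdiff (conjugate g) \<phi>"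
    and uv: "0 \<le> u" "0 \<le> v" "u + v = 1" and t: "conjugate g \<psi> \<le> ereal t"
  have "\<alpha> + dual_apply (\<psi> - \<phi>) x \<le> t" "\<alpha> + dual_apply (\<psi> - \<phi>) y \<le> t"
    using xy t unfolding mem_dual_subdiff_iff[OF \<alpha>] by blast+
  then have "u * (\<alpha> + dual_apply (\<psi> - \<phi>) x) + v * (\<alpha> + dual_apply (\<psi> - \<phi>) y) \<le> t"
    using uv by (intro convex_bound_le)
  then show "\<alpha> + dual_apply (\<psi> - \<phi>) (u *\<^sub>R x + v *\<^sub>R y) \<le> t"
    using uv(3) by (simp only: dual_apply_linear_simps distrib_left)
      (metis (no_types, opaque_lifting) add.assoc add.left_commute distrib_right mult_1)
qed

lemma closed_dual_subdiff:
  assumes \<alpha>: "conjugate g \<phi> = ereal \<alpha>"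
  shows "closed (dual_subdiff (conjugate g) \<phi>)"
proof -
  have "dual_subdiff (conjugate g) \<phi> =
    (\<Inter>\<psi>. \<Inter>t\<in>{t. conjugate g \<psi> \<le> ereal t}. {x. \<alpha> + dual_apply (\<psi> - \<phi>) x \<le> t})"
    by (auto simp: mem_dual_subdiff_iff[OF \<alpha>] simp del: dual_apply_simps)
  moreover have "closed {x. \<alpha> + dual_apply (\<psi> - \<phi>) x \<le> t}" for \<psi> t
    by (intro closed_Collect_le continuous_intros continuous_on_dual_apply)
  ultimately show ?thesis by (simp only:) (intro closed_INT ballI)
qed

lemma dual_subdiff_plus_normal_cone_subset:
  assumes \<alpha>: "conjugate g \<phi> = ereal \<alpha>"
  shows "dual_subdiff (conjugate g) \<phi> + normal_cone (edom (conjugate g)) \<phi> \<subseteq> dual_subdiff (conjugate g) \<phi>"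
proof
  fix z assume "z \<in> dual_subdiff (conjugate g) \<phi> + normal_cone (edom (conjugate g)) \<phi>"
  then obtain x y where z: "z = x + y" and x: "x \<in> dual_subdiff (conjugate g) \<phi>"
    and y: "y \<in> normal_cone (edom (conjugate g)) \<phi>"
    by (rule set_plus_elim)
  show "z \<in> dual_subdiff (conjugate g) \<phi>"
    unfolding mem_dual_subdiff_iff[OF \<alpha>]
  proof (intro allI impI)
    fix \<psi> t assume t: "conjugate g \<psi> \<le> ereal t"
    then have "\<psi> \<in> edom (conjugate g)" by (auto simp: edom_def)
    then have "dual_apply (\<psi> - \<phi>) y \<le> 0" using y unfolding mem_normal_cone_iff by blast
    moreover have "\<alpha> + dual_apply (\<psi> - \<phi>) x \<le> t"
      using x t unfolding mem_dual_subdiff_iff[OF \<alpha>] by blast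
    ultimately show "\<alpha> + dual_apply (\<psi> - \<phi>) z \<le> t"
      unfolding z dual_apply_linear_simps(1) by linarith
  qed
qed

text \<open>The topology \<open>T\<close> is a parameter so that the weak topology and the usual
  topology of a Euclidean space are treated together.\<close>

lemma dual_subdiff_of_continuous_conjugate:
  fixes g :: "'a::{real_vector, topological_space} \<Rightarrow> ereal"
  assumes g: "\<forall>x. g x \<noteq> -\<infinity>" and p: "proper (conjugate g)"
    and \<phi>\<^sub>0: "\<bar>conjugate g \<phi>\<^sub>0\<bar> \<noteq> \<infinity>" "isCont (conjugate g) \<phi>\<^sub>0"
    and T: "topspace T = UNIV"
    and contT: "\<And>\<psi>. continuous_map T euclideanreal (dual_apply \<psi>)"
    and limT: "\<And>\<sigma> x. \<forall>\<psi>. (\<lambda>l. dual_apply \<psi> (\<sigma> l)) \<longlonglongrightarrow> dual_apply \<psi> x \<Longrightarrow> limitin T \<sigma> x sequentially"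
  shows "dual_subdiff (conjugate g) \<phi> =
      convex hull (set_valued_inv (subdiff (lsc_hull T g)) \<phi>) + normal_cone (edom (conjugate g)) \<phi>"
    and "dual_subdiff (conjugate g) \<phi> =
      closure (convex hull (set_valued_inv (subdiff (lsc_hull T g)) \<phi>)) + normal_cone (edom (conjugate g)) \<phi>"
proof -
  let ?D = "dual_subdiff (conjugate g) \<phi>" and ?N = "normal_cone (edom (conjugate g)) \<phi>"
  let ?H = "convex hull (set_valued_inv (subdiff (lsc_hull T g)) \<phi>)"
  have "?D = ?H + ?N \<and> ?D = closure ?H + ?N"
  proof (rule finite_or_infinite_conjugate[OF p, of \<phi>])
    assume "conjugate g \<phi> = \<infinity>"
    then show ?thesis
      by (simp add: dual_subdiff_eq_empty normal_cone_eq_empty set_plus_def)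
  next
    fix \<alpha> assume \<alpha>: "conjugate g \<phi> = ereal \<alpha>"
    \<comment> \<open>The chain \<open>?D\<close>, \<open>?H + ?N\<close>,
      \<open>closure ?H + ?N\<close>, \<open>?D\<close> of inclusions closes up, which yields both
      formulas at once.\<close>
    have "closure ?H \<subseteq> ?D"
      using subdiff_lsc_hull_inverse_subset[OF g T contT \<alpha>] convex_dual_subdiff[OF \<alpha>]
      by (intro closure_minimal hull_minimal closed_dual_subdiff[OF \<alpha>])
    then have "closure ?H + ?N \<subseteq> ?D"
      using dual_subdiff_plus_normal_cone_subset[OF \<alpha>] set_plus_mono2[OF _ order_refl] by blast
    moreover have "?H + ?N \<subseteq> closure ?H + ?N"
      by (intro set_plus_mono2 closure_subset order_refl)
    moreover have "?D \<subseteq> ?H + ?N"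
    proof -
      obtain A \<rho> M where A: "finite A" "0 < \<rho>"
        "\<And>\<psi>. \<forall>a\<in>A. \<bar>dual_apply \<psi> a - dual_apply \<phi>\<^sub>0 a\<bar> < \<rho> \<Longrightarrow> conjugate g \<psi> \<le> ereal M"
        by (rule isCont_ereal_bounded_nbhd[OF \<phi>\<^sub>0]) (rule that; assumption)
      show ?thesis
        using dual_subdiff_subset_of_bounded_nbhd[OF g \<alpha> T contT limT A] by blast
    qed
    ultimately show ?thesis by blast
  qed
  then show "?D = ?H + ?N" "?D = closure ?H + ?N" by blast+
qed

section \<open>Assembly of the three formulas\<close>

lemma dual_subdiff_finite_dimensional_formula:
  fixes g :: "'a::{real_vector, topological_space} \<Rightarrow> ereal"
  assumes g: "\<forall>x. g x \<noteq> -\<infinity>" and p: "proper (conjugate g)"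
  shows "dual_subdiff (conjugate g) \<phi> =
    (\<Inter>L\<in>fin_dim_subspaces \<phi>. convex hull
      (\<Inter>\<epsilon>\<in>{0<..}. weak_topology closure_of
        (set_valued_inv (eps_subdiff \<epsilon> g) \<phi> + normal_cone (L \<inter> edom (conjugate g)) \<phi>)))"
proof (rule finite_or_infinite_conjugate[OF p, of \<phi>])
  assume inf: "conjugate g \<phi> = \<infinity>"
  \<comment> \<open>Where the conjugate is infinite every member of the intersection is empty; one
    member must be exhibited, since an empty intersection would be the whole space.\<close>
  have "span {\<phi>} \<in> fin_dim_subspaces \<phi>"
    unfolding fin_dim_subspaces_def by (auto intro: span_base intro!: exI[of _ "{\<phi>}"])
  moreover have "(\<Inter>\<epsilon>\<in>{0<..}. weak_topology closure_of
      (set_valued_inv (eps_subdiff \<epsilon> g) \<phi> + normal_cone (L \<inter> edom (conjugate g)) \<phi>)) = {}" for L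
    using inf gt_ex[of "0::real"] by (auto simp: normal_cone_eq_empty set_plus_def)
  ultimately show ?thesis using inf by (auto simp: dual_subdiff_eq_empty)
next
  fix \<alpha> assume \<alpha>: "conjugate g \<phi> = ereal \<alpha>"
  show ?thesis
    using dual_subdiff_superset[OF g \<alpha>] dual_subdiff_subset[OF g \<alpha>] by (intro set_eqI iffI INT_I) blast+
qed

text \<open>The coordinate functionals are continuous and linear, and they determine
  convergence.\<close>

lemma limitin_euclidean_of_dual:
  fixes x :: "real ^ 'n"
  assumes "\<forall>\<psi>. (\<lambda>l. dual_apply \<psi> (\<sigma> l)) \<longlonglongrightarrow> dual_apply \<psi> x"
  shows "limitin euclidean \<sigma> x sequentially"
  unfolding limitin_canonical_iff
proof (rule vec_tendstoI)
  fix i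
  have "linear (\<lambda>y::real^'n. y $ i)" by (auto intro: linearI)
  then have "dual_apply (Dual (\<lambda>y::real^'n. y $ i)) = (\<lambda>y. y $ i)"
    by (intro Dual_inverse) (auto intro: continuous_intros)
  then show "(\<lambda>l. \<sigma> l $ i) \<longlonglongrightarrow> x $ i"
    using assms[rule_format, of "Dual (\<lambda>y. y $ i)"] by simp
qed

text \<open>The Euclidean case has its own function \<open>h\<close>, because its type is an
  instance of the general one.\<close>

theorem proposition14:
  fixes g :: "'a::locally_convex_space \<Rightarrow> ereal"
    and h :: "real ^ 'n \<Rightarrow> ereal"
  shows
    "((\<forall>x. g x \<noteq> -\<infinity>) \<and> proper (conjugate g) \<longrightarrow>
        (\<forall>\<phi>. dual_subdiff (conjugate g) \<phi> =
          (\<Inter>L\<in>fin_dim_subspaces \<phi>. convex hull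
            (\<Inter>\<epsilon>\<in>{0<..}. weak_topology closure_of
              (set_valued_inv (eps_subdiff \<epsilon> g) \<phi> +
               normal_cone (L \<inter> edom (conjugate g)) \<phi>)))) \<and>
        ((\<exists>\<phi>\<^sub>0. \<bar>conjugate g \<phi>\<^sub>0\<bar> \<noteq> \<infinity> \<and> isCont (conjugate g) \<phi>\<^sub>0) \<longrightarrow>
          (\<forall>\<phi>. dual_subdiff (conjugate g) \<phi> =
            closure (convex hull (set_valued_inv (subdiff (lsc_hull weak_topology g)) \<phi>)) +
            normal_cone (edom (conjugate g)) \<phi>)))
     \<and>
     ((\<forall>x. h x \<noteq> -\<infinity>) \<and> proper (conjugate h) \<and>
        (\<exists>\<phi>\<^sub>0. \<bar>conjugate h \<phi>\<^sub>0\<bar> \<noteq> \<infinity> \<and> isCont (conjugate h) \<phi>\<^sub>0) \<longrightarrow>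
        (\<forall>\<phi>. dual_subdiff (conjugate h) \<phi> =
          (convex hull (set_valued_inv (subdiff (lsc_hull euclidean h)) \<phi>)) +
          normal_cone (edom (conjugate h)) \<phi>))"
proof (intro conjI impI allI)
  fix \<phi> assume "(\<forall>x. g x \<noteq> -\<infinity>) \<and> proper (conjugate g)"
  then show "dual_subdiff (conjugate g) \<phi> =
      (\<Inter>L\<in>fin_dim_subspaces \<phi>. convex hull
        (\<Inter>\<epsilon>\<in>{0<..}. weak_topology closure_of
          (set_valued_inv (eps_subdiff \<epsilon> g) \<phi> + normal_cone (L \<inter> edom (conjugate g)) \<phi>)))"
    by (intro dual_subdiff_finite_dimensional_formula) auto
next
  fix \<phi> assume g: "(\<forall>x. g x \<noteq> -\<infinity>) \<and> proper (conjugate g)"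
    and "\<exists>\<phi>\<^sub>0. \<bar>conjugate g \<phi>\<^sub>0\<bar> \<noteq> \<infinity> \<and> isCont (conjugate g) \<phi>\<^sub>0"
  from this(2) obtain \<phi>\<^sub>0 where \<phi>\<^sub>0: "\<bar>conjugate g \<phi>\<^sub>0\<bar> \<noteq> \<infinity>" "isCont (conjugate g) \<phi>\<^sub>0"
    by (elim exE conjE) (rule that)
  show "dual_subdiff (conjugate g) \<phi> =
      closure (convex hull (set_valued_inv (subdiff (lsc_hull weak_topology g)) \<phi>)) +
      normal_cone (edom (conjugate g)) \<phi>"
    by (rule dual_subdiff_of_continuous_conjugate(2)[OF conjunct1[OF g] conjunct2[OF g] \<phi>\<^sub>0
          topspace_weak_topology continuous_map_weak_topology])
      (simp add: limitin_weak_topology)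
next
  fix \<phi> assume h: "(\<forall>x. h x \<noteq> -\<infinity>) \<and> proper (conjugate h) \<and>
    (\<exists>\<phi>\<^sub>0. \<bar>conjugate h \<phi>\<^sub>0\<bar> \<noteq> \<infinity> \<and> isCont (conjugate h) \<phi>\<^sub>0)"
  then obtain \<phi>\<^sub>0 where \<phi>\<^sub>0: "\<bar>conjugate h \<phi>\<^sub>0\<bar> \<noteq> \<infinity>" "isCont (conjugate h) \<phi>\<^sub>0"
    by (elim exE conjE) (rule that)
  have "continuous_map euclidean euclideanreal (dual_apply \<psi>)" for \<psi> :: "(real ^ 'n) top_dual"
    using continuous_on_dual_apply by simp
  then show "dual_subdiff (conjugate h) \<phi> =
      convex hull (set_valued_inv (subdiff (lsc_hull euclidean h)) \<phi>) + normal_cone (edom (conjugate h)) \<phi>"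
    using h \<phi>\<^sub>0
    by (intro dual_subdiff_of_continuous_conjugate(1)[OF _ _ _ _ topspace_euclidean _ limitin_euclidean_of_dual])
      blast+
qed

end
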